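(* Let $X$ be a Polish space. Then $BP(X) \subseteq EBP(X)$. Moreover, the containment $BP(X) \subseteq EBP(X)$ is proper in all models of ZFC + Martin's Axiom or, less generally, of ZFC + the Continuum Hypothesis.
   Context: A Polish space is a separable completely metrizable topological space. For a Polish space $X$, $BP(X)$ is the collection of all subsets $A \subseteq X$ with the Baire property, i.e. such that $U \triangle A$ (symmetric difference) is meager for some open $U \subseteq X$. $\mathcal{M}(X)$ is the set of all Borel probability measures on $X$ with the coarsest topology for which each map $\mu \mapsto \int f\,d\mu$, with $f : X \to \mathbb{R}$ bounded and continuous, is continuous ($\mathcal{M}(X)$ is then Polish). For $A \subseteq X$, $\mathcal{N}(A) = \{\mu \in \mathcal{M}(X) : \mu^*(A) = 0\}$, where $\mu^*$ is the outer measure induced by $\mu$. $A$ is residually null if $\mathcal{N}(A)$ is co-meager in $\mathcal{M}(X)$. $EBP(X)$ is the collection of all $A \subseteq X$ (called EBP-sets) for which there is an open set $U \subseteq X$ such that $U \triangle A$ is residually null. Martin's Axiom is the assertion that for every cardinal $\kappa < \mathfrak{c} = 2^{\aleph_0}$, for every nonempty compact Hausdorff space $K$ with countable cellularity (every family of pairwise disjoint open subsets of $K$ is countable), and for every collection $\mathscr{U}$ of at most $\kappa$ open dense subsets of $K$, $\bigcap \mathscr{U} \neq \emptyset$.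
   Formalization: Properness of the containment is claimed only when the isolated points of X are not dense in X; otherwise (e.g. X countable) every subset of X has the Baire property, so BP(X) = EBP(X) and properness fails. *)

theory Defs
  imports "HOL-Probability.Probability"
begin

unbundle cardinal_syntax

definition Polish_space :: "'a topology \<Rightarrow> bool" where
  "Polish_space X \<longleftrightarrow> separable_space X \<and> completely_metrizable_space X"

definition nowhere_dense_in :: "'a topology \<Rightarrow> 'a set \<Rightarrow> bool" where
  "nowhere_dense_in X A \<longleftrightarrow> A \<subseteq> topspace X \<and> X interior_of (X closure_of A) = {}"

definition meager_in :: "'a topology \<Rightarrow> 'a set \<Rightarrow> bool" where
  "meager_in X A \<longleftrightarrow> (\<exists>F :: nat \<Rightarrow> 'a set. (\<forall>n. nowhere_dense_in X (F n)) \<and> A = (\<Union>n. F n))"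

definition comeager_in :: "'a topology \<Rightarrow> 'a set \<Rightarrow> bool" where
  "comeager_in X A \<longleftrightarrow> A \<subseteq> topspace X \<and> meager_in X (topspace X - A)"

definition BP :: "'a topology \<Rightarrow> 'a set set" where
  "BP X = {A. A \<subseteq> topspace X \<and> (\<exists>U. openin X U \<and> meager_in X (sym_diff U A))}"

definition borel_of :: "'a topology \<Rightarrow> 'a measure" where
  "borel_of X = sigma (topspace X) {U. openin X U}"

definition prob_measures :: "'a topology \<Rightarrow> 'a measure set" where
  "prob_measures X = {\<mu>. sets \<mu> = sets (borel_of X) \<and> prob_space \<mu>}"

definition prob_topology :: "'a topology \<Rightarrow> 'a measure topology" where
  "prob_topology X = topology_generated_by
     {{\<mu> \<in> prob_measures X. (\<integral>x. f x \<partial>\<mu>) \<in> V} | f V.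
        continuous_map X euclideanreal f \<and> bounded (f ` topspace X) \<and> open V}"

lemma topspace_prob_topology: "topspace (prob_topology X) = prob_measures X"
proof -
  let ?S = "{{\<mu> \<in> prob_measures X. (\<integral>x. f x \<partial>\<mu>) \<in> V} | f V.
        continuous_map X euclideanreal f \<and> bounded (f ` topspace X) \<and> open V}"
  have "bounded ((\<lambda>_::'a. 0::real) ` topspace X)"
    by (rule bounded_subset[of "{0}"]) auto
  then have "prob_measures X \<in> ?S"
    by (intro CollectI exI[of _ "\<lambda>_. 0"] exI[of _ UNIV]) auto
  then have "\<Union>?S = prob_measures X"
    by blast
  then show ?thesis
    by (simp add: prob_topology_def)
qed

definition null_measures :: "'a topology \<Rightarrow> 'a set \<Rightarrow> 'a measure set" where
  "null_measures X A = {\<mu> \<in> prob_measures X. outer_measure_of \<mu> A = 0}"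

definition residually_null :: "'a topology \<Rightarrow> 'a set \<Rightarrow> bool" where
  "residually_null X A \<longleftrightarrow> A \<subseteq> topspace X \<and> comeager_in (prob_topology X) (null_measures X A)"

definition EBP :: "'a topology \<Rightarrow> 'a set set" where
  "EBP X = {A. A \<subseteq> topspace X \<and> (\<exists>U. openin X U \<and> residually_null X (sym_diff U A))}"

definition continuum :: "nat set rel" where
  "continuum = |UNIV :: nat set set|"

definition Continuum_Hypothesis :: bool where
  "Continuum_Hypothesis \<longleftrightarrow> continuum =o cardSuc natLeq"

definition countable_cellularity :: "'a topology \<Rightarrow> bool" where
  "countable_cellularity K \<longleftrightarrow>
     (\<forall>\<V>. (\<forall>V\<in>\<V>. openin K V) \<and> pairwise disjnt \<V> \<longrightarrow> countable \<V>)"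

text \<open>
  HOL cannot quantify over the carrier type of \<open>K\<close> inside a formula. The type \<open>nat set set\<close> has
  \<open>2\<close> to the continuum many elements, and this loses nothing: given an arbitrary compact Hausdorff \<open>K\<close>
  with countable cellularity and fewer than continuum many dense open sets \<open>U\<close>, choose for each
  \<open>U\<close> a maximal disjoint (hence countable) family of regular open sets with closure inside \<open>U\<close>.
  All these sets generate a Boolean subalgebra of the regular open algebra of \<open>K\<close> with fewer than
  continuum many elements (or a countable one); its Stone space is compact Hausdorff with countable
  cellularity and has at most \<open>2\<close> to the continuum many points. An ultrafilter there meeting each
  of the chosen families yields, by compactness of \<open>K\<close>, a point of \<open>K\<close> in all of the \<open>U\<close>.
\<close>

definition Martins_Axiom :: bool where
  "Martins_Axiom \<longleftrightarrow>
     (\<forall>\<kappa> :: nat set rel. Card_order \<kappa> \<and> \<kappa> <o continuum \<longrightarrow>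
       (\<forall>(K :: nat set set topology) \<U>.
          topspace K \<noteq> {} \<and> compact_space K \<and> Hausdorff_space K \<and> countable_cellularity K \<and>
          |\<U>| \<le>o \<kappa> \<and> (\<forall>U\<in>\<U>. openin K U \<and> K closure_of U = topspace K) \<longrightarrow>
          topspace K \<inter> \<Inter>\<U> \<noteq> {}))"

definition isolated_points_in :: "'a topology \<Rightarrow> 'a set" where
  "isolated_points_in X = {x \<in> topspace X. openin X {x}}"

text \<open>
  If the isolated points are dense (for example if \<open>X\<close> is a countable Polish space), then every subset of \<open>X\<close>
  has the Baire property and properness is impossible, whatever the set theory.
\<close>

lemma BP_eq_Pow_if_isolated_dense:
  assumes "X closure_of (isolated_points_in X) = topspace X"
  shows "BP X = Pow (topspace X)" "\<not> BP X \<subset> EBP X"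
proof -
  let ?I = "isolated_points_in X"
  have op: "openin X U" if "U \<subseteq> ?I" for U
  proof -
    have "openin X (\<Union>x\<in>U. {x})"
      using that by (intro openin_Union) (auto simp: isolated_points_in_def)
    then show ?thesis by simp
  qed
  have nd: "nowhere_dense_in X A" if "A \<subseteq> topspace X - ?I" for A
  proof -
    have "X closure_of A \<subseteq> topspace X - ?I"
      using that op[of ?I] by (intro closure_of_minimal) auto
    moreover have "X interior_of (topspace X - ?I) = {}"
      using assms by (simp add: interior_of_complement)
    ultimately show ?thesis
      using that interior_of_mono[of "X closure_of A" "topspace X - ?I" X]
      by (auto simp: nowhere_dense_in_def)
  qed
  have "A \<in> BP X" if "A \<subseteq> topspace X" for A
  proof -
    have "nowhere_dense_in X (sym_diff (A \<inter> ?I) A)"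
      using that by (intro nd) auto
    then have "meager_in X (sym_diff (A \<inter> ?I) A)"
      unfolding meager_in_def by (intro exI[of _ "\<lambda>_. sym_diff (A \<inter> ?I) A"]) auto
    then show ?thesis
      using that op[of "A \<inter> ?I"] by (auto simp: BP_def)
  qed
  then show eq: "BP X = Pow (topspace X)"
    by (auto simp: BP_def)
  show "\<not> BP X \<subset> EBP X"
    unfolding eq by (auto simp: EBP_def)
qed

end

theory Submission
  imports Defs
begin

text \<open>
  Residual nullity of meager sets rests on two facts about the space of Borel probability measures on \<open>X\<close>:
  the mass of a closed set is upper semicontinuous, and discrete measures with atoms chosen in any
  prescribed dense set are dense. For a closed nowhere dense \<open>F\<close> the measures giving mass below \<open>1 / n\<close>
  to \<open>F\<close> therefore form a dense open set, so generic measures vanish on \<open>F\<close>, and countable unions give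
  \<open>meager_imp_residually_null\<close>. The inclusion of \<open>BP X\<close> in \<open>EBP X\<close> follows with the same open set \<open>U\<close>.

  For properness, both Martin's Axiom and the Continuum Hypothesis enter only through the consequence that
  a nonempty Polish space is not the union of fewer than continuum many closed nowhere dense sets
  (\<open>small_Baire\<close>). The witness is a generalized Lusin set \<open>A\<close> inside the open set \<open>W\<close> off the closure of the
  isolated points (\<open>generalized_Lusin_set\<close>): a transfinite recursion of length continuum makes \<open>A\<close> meet every
  meager set in fewer than continuum many points and fail to have the Baire property.
  It remains to see that \<open>A\<close> is residually null. Generic measures have no atoms in the closure of \<open>W\<close>
  (\<open>comeager_no_atoms\<close>). Such a measure is concentrated, within \<open>W\<close>, on a meager set: around a countable
  dense set, which has measure zero, there are open sets of arbitrarily small measure. The part of \<open>A\<close> in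
  that meager set has fewer than continuum many points, all of mass zero, and is null by a Baire category
  argument in the space of sequences of naturals (\<open>open_cover_of_small_set\<close>).
\<close>

section \<open>Comeager sets\<close>

lemma nowhere_dense_in_complement_dense_open:
  assumes "openin Y U" "Y closure_of U = topspace Y"
  shows "nowhere_dense_in Y (topspace Y - U)"
  using assms
  by (simp add: nowhere_dense_in_def closure_of_complement interior_of_complement interior_of_openin)

lemma meager_in_UN:
  fixes A :: "nat \<Rightarrow> 'a set"
  assumes "\<And>n. meager_in Y (A n)"
  shows "meager_in Y (\<Union>n. A n)"
proof -
  obtain F where F: "\<And>n k::nat. nowhere_dense_in Y (F n k)" "\<And>n. A n = (\<Union>k. F n k)"
    using assms unfolding meager_in_def by metis
  define G where "G m = F (fst (prod_decode m)) (snd (prod_decode m))" for m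
  have "F n k = G (prod_encode (n, k))" for n k by (simp add: G_def)
  then have "F n k \<subseteq> (\<Union>m. G m)" for n k by (metis UNIV_I UN_upper)
  then have "(\<Union>n. A n) = (\<Union>m. G m)"
    unfolding F(2) by (fastforce simp: G_def)
  moreover have "nowhere_dense_in Y (G m)" for m
    using F(1) by (simp add: G_def)
  ultimately show ?thesis
    unfolding meager_in_def by (intro exI[of _ G]) simp
qed

lemma meager_in_subset:
  assumes "meager_in Y A" "B \<subseteq> A"
  shows "meager_in Y B"
proof -
  obtain F where F: "\<And>n::nat. nowhere_dense_in Y (F n)" "A = (\<Union>n. F n)"
    using assms(1) unfolding meager_in_def by metis
  have "nowhere_dense_in Y (F n \<inter> B)" for n
    using F(1)[of n] interior_of_mono[OF closure_of_mono, of "F n \<inter> B" "F n" Y Y]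
    by (auto simp: nowhere_dense_in_def)
  moreover have "B = (\<Union>n. F n \<inter> B)" using F(2) assms(2) by blast
  ultimately show ?thesis unfolding meager_in_def by (intro exI[of _ "\<lambda>n. F n \<inter> B"]) blast
qed

lemma comeager_in_dense_open:
  assumes "openin Y U" "Y closure_of U = topspace Y"
  shows "comeager_in Y U"
  unfolding comeager_in_def meager_in_def
  using assms openin_subset nowhere_dense_in_complement_dense_open[OF assms]
  by (metis UN_constant UNIV_not_empty)

lemma comeager_in_INT:
  fixes A :: "nat \<Rightarrow> 'a set"
  assumes "\<And>n. comeager_in Y (A n)"
  shows "comeager_in Y (\<Inter>n. A n)"
proof -
  have "topspace Y - (\<Inter>n. A n) = (\<Union>n. topspace Y - A n)" by blast
  moreover have "(\<Inter>n. A n) \<subseteq> topspace Y" using assms by (auto simp: comeager_in_def)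
  ultimately show ?thesis
    using assms meager_in_UN[of Y "\<lambda>n. topspace Y - A n"] by (simp add: comeager_in_def)
qed

lemma comeager_in_mono:
  assumes "comeager_in Y A" "A \<subseteq> B" "B \<subseteq> topspace Y"
  shows "comeager_in Y B"
  using assms meager_in_subset[of Y "topspace Y - A" "topspace Y - B"]
  by (auto simp: comeager_in_def)

section \<open>Borel probability measures on a Polish space\<close>

lemma Polish_space_metrizable: "Polish_space X \<Longrightarrow> metrizable_space X"
  by (simp add: Polish_space_def completely_metrizable_imp_metrizable_space)

lemma Polish_space_countable_base:
  assumes "Polish_space X"
  obtains b :: "nat \<Rightarrow> 'a set" where "\<And>n. openin X (b n)"
    "\<And>U x. openin X U \<Longrightarrow> x \<in> U \<Longrightarrow> \<exists>n. x \<in> b n \<and> b n \<subseteq> U"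
proof -
  obtain M d where "Metric_space M d" and X: "X = Metric_space.mtopology M d"
    using Polish_space_metrizable[OF assms] by (auto simp: metrizable_space_def)
  then interpret Metric_space M d by simp
  obtain C where C: "countable C" "C \<subseteq> M" "mtopology closure_of C = M"
    using assms X by (auto simp: Polish_space_def separable_space_def)
  define B where "B = insert {} ((\<lambda>(c, k::nat). mball c (1 / Suc k)) ` (C \<times> UNIV))"
  have cB: "countable B" "B \<noteq> {}" using C(1) by (auto simp: B_def)
  have op: "openin X V" if "V \<in> B" for V using that by (auto simp: B_def X)
  have base: "\<exists>V\<in>B. x \<in> V \<and> V \<subseteq> U" if U: "openin X U" and x: "x \<in> U" for U x
  proof -
    obtain r where r: "r > 0" "mball x r \<subseteq> U" and xM: "x \<in> M"
      using U x unfolding X openin_mtopology by blast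
    obtain k :: nat where k: "1 / Suc k < r / 2" using nat_approx_posE[of "r/2"] r(1) by auto
    have "x \<in> mtopology closure_of C" using C xM by simp
    then obtain c where c: "c \<in> C" "c \<in> mball x (1 / Suc k)"
      unfolding metric_closure_of by (force dest!: spec[of _ "1 / Suc k"])
    have "mball c (1 / Suc k) \<subseteq> mball x r"
    proof
      fix y assume "y \<in> mball c (1 / Suc k)"
      then show "y \<in> mball x r"
        using c(2) k triangle[of x c y] by (auto simp: in_mball)
    qed
    moreover have "x \<in> mball c (1 / Suc k)" using c(2) by (simp add: in_mball commute)
    moreover have "mball c (1 / Suc k) \<in> B" using c(1) by (auto simp: B_def)
    ultimately show ?thesis using r(2) by blast
  qed
  show ?thesis
  proof (rule that[of "from_nat_into B"])
    show "openin X (from_nat_into B n)" for n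
      using op from_nat_into[OF cB(2)] by blast
    fix U x assume "openin X U" "x \<in> U"
    then obtain V where V: "V \<in> B" "x \<in> V" "V \<subseteq> U" using base by blast
    then obtain n where "from_nat_into B n = V" using from_nat_into_surj[OF cB(1)] by blast
    with V show "\<exists>n. x \<in> from_nat_into B n \<and> from_nat_into B n \<subseteq> U" by blast
  qed
qed

lemma space_borel_of [simp]: "space (borel_of X) = topspace X"
  by (simp add: borel_of_def space_measure_of_conv)

lemma sets_borel_of: "sets (borel_of X) = sigma_sets (topspace X) {U. openin X U}"
  unfolding borel_of_def by (rule sets_measure_of) (auto dest: openin_subset)

context
  fixes X :: "'a topology" and \<mu> :: "'a measure"
  assumes \<mu>: "\<mu> \<in> prob_measures X"
begin

lemma prob_space_of_prob_measures: "prob_space \<mu>"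
  using \<mu> by (simp add: prob_measures_def)

lemma space_of_prob_measures: "space \<mu> = topspace X"
  using \<mu> sets_eq_imp_space_eq[of \<mu> "borel_of X"] by (simp add: prob_measures_def)

lemma sets_of_prob_measures: "sets \<mu> = sets (borel_of X)"
  using \<mu> by (simp add: prob_measures_def)

lemma open_in_sets: "openin X U \<Longrightarrow> U \<in> sets \<mu>"
  by (simp add: sets_of_prob_measures sets_borel_of sigma_sets.Basic)

lemma closed_in_sets: "closedin X F \<Longrightarrow> F \<in> sets \<mu>"
  using open_in_sets[of "topspace X - F"] sets.Diff[OF sets.top, of "topspace X - F" \<mu>]
  by (simp add: space_of_prob_measures closedin_def double_diff)

lemma continuous_map_measurable:
  assumes "continuous_map X euclideanreal f"
  shows "f \<in> borel_measurable \<mu>"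
proof (rule borel_measurableI)
  fix S :: "real set" assume "open S"
  then have "openin X {x \<in> topspace X. f x \<in> S}"
    using assms openin_continuous_map_preimage by fastforce
  moreover have "f -` S \<inter> space \<mu> = {x \<in> topspace X. f x \<in> S}"
    by (auto simp: space_of_prob_measures)
  ultimately show "f -` S \<inter> space \<mu> \<in> sets \<mu>" by (simp add: open_in_sets)
qed

lemma continuous_map_integrable:
  assumes "continuous_map X euclideanreal f" "bounded (f ` topspace X)"
  shows "integrable \<mu> f"
proof -
  obtain B where B: "\<And>x. x \<in> topspace X \<Longrightarrow> norm (f x) \<le> B"
    using assms(2) by (auto simp: bounded_iff)
  interpret prob_space \<mu> by (rule prob_space_of_prob_measures)
  show ?thesis
    by (rule integrable_const_bound[where B=B])
      (use B in \<open>auto simp: space_of_prob_measures continuous_map_measurable[OF assms(1)] intro!: AE_I2\<close>)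
qed

end

lemma openin_prob_topology_integral:
  assumes "continuous_map X euclideanreal f" "bounded (f ` topspace X)" "open V"
  shows "openin (prob_topology X) {\<mu> \<in> prob_measures X. (\<integral>x. f x \<partial>\<mu>) \<in> V}"
  unfolding prob_topology_def using assms by (intro topology_generated_by_Basis) blast

text \<open>
  The mass of an open set \<open>U\<close> is lower semicontinuous: \<open>U\<close> is an increasing union of closed sets, one of
  which already has mass above \<open>r\<close>, and a Urysohn function between that closed set and the complement
  of \<open>U\<close> has integral above \<open>r\<close>, which is an open condition.
\<close>

lemma openin_prob_topology_measure_open:
  assumes X: "metrizable_space X" and U: "openin X U"
  shows "openin (prob_topology X) {\<mu> \<in> prob_measures X. measure \<mu> U > r}" (is "openin ?T ?G")
proof (subst openin_subopen, intro ballI)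
  fix \<mu> assume "\<mu> \<in> ?G"
  then have \<mu>: "\<mu> \<in> prob_measures X" and gt: "measure \<mu> U > r" by auto
  interpret prob_space \<mu> by (rule prob_space_of_prob_measures[OF \<mu>])
  obtain C where C: "\<And>n::nat. closedin X (C n)" "\<And>n. C n \<subseteq> C (Suc n)" "(\<Union>n. C n) = U"
    using open_imp_fsigma_in[OF X U] unfolding fsigma_in_ascending by metis
  have "(\<lambda>n. measure \<mu> (C n)) \<longlonglongrightarrow> measure \<mu> (\<Union>n. C n)"
    using C by (intro finite_Lim_measure_incseq) (auto simp: incseq_Suc_iff closed_in_sets[OF \<mu>])
  then have "\<forall>\<^sub>F n in sequentially. measure \<mu> (C n) > r"
    using gt C(3) by (intro order_tendstoD) auto
  then obtain n where n: "measure \<mu> (C n) > r" by (auto simp: eventually_sequentially)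
  have "C n \<subseteq> U" using C(3) by blast
  then have "disjnt (C n) (topspace X - U)" by (auto simp: disjnt_def)
  then have "disjnt (topspace X - U) (C n)" by (simp add: disjnt_sym)
  moreover have "closedin X (topspace X - U)" using U by blast
  ultimately obtain f where f: "continuous_map X (top_of_set {0..1::real}) f"
      "f ` (topspace X - U) \<subseteq> {0}" "f ` C n \<subseteq> {1}"
    using Urysohn_lemma[OF metrizable_imp_normal_space[OF X] _ C(1)[of n], of "topspace X - U" 0 1]
    by auto
  have fc: "continuous_map X euclideanreal f" and f01: "\<And>x. x \<in> topspace X \<Longrightarrow> 0 \<le> f x \<and> f x \<le> 1"
    using f(1) by (auto simp: continuous_map_in_subtopology Pi_iff)
  have fb: "bounded (f ` topspace X)"
    using f01 by (intro boundedI[of _ 1]) auto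
  define H where "H = {\<nu> \<in> prob_measures X. (\<integral>x. f x \<partial>\<nu>) \<in> {r<..}}"
  show "\<exists>T. openin ?T T \<and> \<mu> \<in> T \<and> T \<subseteq> ?G"
  proof (intro exI conjI)
    show "openin ?T H" unfolding H_def
      by (rule openin_prob_topology_integral[OF fc fb]) auto
    have "measure \<mu> (C n) = (\<integral>x. indicator (C n) x \<partial>\<mu>)"
      using closed_in_sets[OF \<mu> C(1)] by simp
    also have "\<dots> \<le> (\<integral>x. f x \<partial>\<mu>)"
      using f f01 closed_in_sets[OF \<mu> C(1)]
      by (intro integral_mono continuous_map_integrable[OF \<mu> fc fb] integrable_real_indicator)
        (auto simp: space_of_prob_measures[OF \<mu>] emeasure_eq_measure split: split_indicator)
    finally show "\<mu> \<in> H" using n \<mu> by (simp add: H_def)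
    show "H \<subseteq> ?G"
    proof
      fix \<nu> assume "\<nu> \<in> H"
      then have \<nu>: "\<nu> \<in> prob_measures X" and gt: "(\<integral>x. f x \<partial>\<nu>) > r" by (auto simp: H_def)
      interpret \<nu>: prob_space \<nu> by (rule prob_space_of_prob_measures[OF \<nu>])
      have "(\<integral>x. f x \<partial>\<nu>) \<le> (\<integral>x. indicator U x \<partial>\<nu>)"
        using f f01 open_in_sets[OF \<nu> U]
        by (intro integral_mono continuous_map_integrable[OF \<nu> fc fb] integrable_real_indicator)
          (auto simp: space_of_prob_measures[OF \<nu>] \<nu>.emeasure_eq_measure image_subset_iff
            split: split_indicator)
      also have "\<dots> = measure \<nu> U" using open_in_sets[OF \<nu> U] by simp
      finally show "\<nu> \<in> ?G" using gt \<nu> by simp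
    qed
  qed
qed

lemma measure_closed_eq:
  assumes "\<mu> \<in> prob_measures X" "closedin X F"
  shows "measure \<mu> F = 1 - measure \<mu> (topspace X - F)"
  using prob_space.prob_compl[OF prob_space_of_prob_measures[OF assms(1)] closed_in_sets[OF assms]]
  by (simp add: space_of_prob_measures[OF assms(1)])

lemma openin_prob_topology_measure_closed:
  assumes X: "metrizable_space X" and F: "closedin X F"
  shows "openin (prob_topology X) {\<mu> \<in> prob_measures X. measure \<mu> F < r}"
proof -
  have "{\<mu> \<in> prob_measures X. measure \<mu> F < r}
      = {\<mu> \<in> prob_measures X. measure \<mu> (topspace X - F) > 1 - r}"
    using measure_closed_eq[OF _ F] by auto
  then show ?thesis
    using openin_prob_topology_measure_open[OF X, of "topspace X - F"] F by (simp add: closedin_def)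
qed

lemma prob_small_open_neighbourhood:
  assumes X: "metrizable_space X" and \<mu>: "\<mu> \<in> prob_measures X" and x: "x \<in> topspace X"
    and less: "measure \<mu> {x} < e"
  obtains V where "openin X V" "x \<in> V" "measure \<mu> (X closure_of V) < e"
proof -
  obtain M d where "Metric_space M d" and Xd: "X = Metric_space.mtopology M d"
    using X by (auto simp: metrizable_space_def)
  then interpret Metric_space M d by simp
  interpret \<mu>: prob_space \<mu> by (rule prob_space_of_prob_measures[OF \<mu>])
  define C where "C n = mcball x (1 / Suc n)" for n
  have xM: "x \<in> M" using x Xd by simp
  have cl: "closedin X (C n)" for n by (simp add: C_def Xd)
  have "(\<Inter>n. C n) = {x}"
  proof (intro equalityI subsetI)
    fix y assume "y \<in> (\<Inter>n. C n)"
    then have y: "y \<in> M" "\<And>n. d x y \<le> 1 / Suc n" by (auto simp: C_def in_mcball)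
    have "\<not> 0 < d x y"
      using y(2) nat_approx_posE[of "d x y"] by (meson not_less)
    then show "y \<in> {x}" using xM y(1) by (metis nonneg order_le_less singletonI zero)
  qed (use xM in \<open>auto simp: C_def in_mcball\<close>)
  moreover have "decseq C"
    unfolding decseq_Suc_iff C_def by (intro allI mcball_subset_concentric frac_le) auto
  then have "(\<lambda>n. measure \<mu> (C n)) \<longlonglongrightarrow> measure \<mu> (\<Inter>n. C n)"
    using closed_in_sets[OF \<mu> cl] by (intro \<mu>.finite_Lim_measure_decseq) blast+
  ultimately have "\<forall>\<^sub>F n in sequentially. measure \<mu> (C n) < e"
    using less by (intro order_tendstoD) auto
  then obtain n where n: "measure \<mu> (C n) < e" by (auto simp: eventually_sequentially)
  have "X closure_of (mball x (1 / Suc n)) \<subseteq> C n"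
    using cl[of n] by (intro closure_of_minimal) (auto simp: C_def in_mball in_mcball)
  then have "measure \<mu> (X closure_of (mball x (1 / Suc n))) \<le> measure \<mu> (C n)"
    using closed_in_sets[OF \<mu> cl] by (intro \<mu>.finite_measure_mono)
  then show ?thesis using n xM by (intro that[of "mball x (1 / Suc n)"]) (auto simp: Xd)
qed

section \<open>Discrete measures are dense\<close>

lemma prob_topology_neighbourhood:
  assumes "openin (prob_topology X) N" "\<mu> \<in> N"
  obtains fs :: "('a \<Rightarrow> real) list" and d where "d > 0"
    "\<And>f. f \<in> set fs \<Longrightarrow> continuous_map X euclideanreal f \<and> bounded (f ` topspace X)"
    "\<And>\<nu>. \<nu> \<in> prob_measures X \<Longrightarrow>
       (\<And>f. f \<in> set fs \<Longrightarrow> \<bar>(\<integral>x. f x \<partial>\<nu>) - (\<integral>x. f x \<partial>\<mu>)\<bar> < d) \<Longrightarrow> \<nu> \<in> N"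
proof -
  let ?Q = "\<lambda>N fs d. d > 0 \<and>
    (\<forall>f\<in>set fs. continuous_map X euclideanreal f \<and> bounded (f ` topspace X)) \<and>
    (\<forall>\<nu>\<in>prob_measures X. (\<forall>f\<in>set fs. \<bar>(\<integral>x. f x \<partial>\<nu>) - (\<integral>x. f x \<partial>\<mu>)\<bar> < d) \<longrightarrow> \<nu> \<in> N)"
  have "\<mu> \<in> N \<longrightarrow> (\<exists>fs d. ?Q N fs d)"
    using assms(1) unfolding prob_topology_def openin_topology_generated_by_iff
  proof (induction rule: generate_topology_on.induct)
    case Empty
    then show ?case by simp
  next
    case (Int A B)
    show ?case
    proof
      assume "\<mu> \<in> A \<inter> B"
      then obtain fs d gs e where "?Q A fs d" "?Q B gs e"
        using Int.IH by blast
      then have "?Q (A \<inter> B) (fs @ gs) (min d e)" by (auto simp: ball_Un)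
      then show "\<exists>fs d. ?Q (A \<inter> B) fs d" by blast
    qed
  next
    case (UN K)
    show ?case
    proof
      assume "\<mu> \<in> \<Union>K"
      then obtain k where k: "k \<in> K" "\<mu> \<in> k" by blast
      then obtain fs d where "?Q k fs d" using UN.IH by blast
      then have "?Q (\<Union>K) fs d" using k(1) by blast
      then show "\<exists>fs d. ?Q (\<Union>K) fs d" by blast
    qed
  next
    case (Basis A)
    show ?case
    proof
      assume \<mu>: "\<mu> \<in> A"
      obtain f V where A: "A = {\<mu> \<in> prob_measures X. (\<integral>x. f x \<partial>\<mu>) \<in> V}"
        and f: "continuous_map X euclideanreal f" "bounded (f ` topspace X)" and V: "open V"
        using Basis by blast
      obtain d where d: "d > 0" "\<And>y. \<bar>y - (\<integral>x. f x \<partial>\<mu>)\<bar> < d \<Longrightarrow> y \<in> V"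
        using V \<mu> unfolding A open_real by blast
      have "?Q A [f] d" using d f by (simp add: A)
      then show "\<exists>fs d. ?Q A fs d" by blast
    qed
  qed
  then obtain fs d where "?Q N fs d" using assms(2) by blast
  then show ?thesis by (intro that[of d fs]) auto
qed

lemma integral_bind_pmf_bounded:
  fixes f :: "'b \<Rightarrow> real"
  assumes "\<And>x. \<bar>f x\<bar> \<le> B"
  shows "(\<integral>x. f x \<partial>measure_pmf (bind_pmf q P)) = (\<integral>l. (\<integral>x. f x \<partial>measure_pmf (P l)) \<partial>measure_pmf q)"
  unfolding measure_pmf_bind
  by (rule integral_bind[where K="count_space UNIV" and B=B and B'=1])
    (use assms measurable_measure_pmf[of P] in \<open>auto simp: measure_pmf.finite_measure_axioms\<close>)

text \<open>
  Density of discrete measures, in a form that leaves freedom in the choice of the atoms: as long as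
  every nonempty open set carries a discrete measure with atoms in \<open>S\<close> of mass at most \<open>e\<close>, these
  measures are dense. Finitely many bounded continuous functions cut \<open>X\<close> into countably many cells on
  which each of them oscillates little. Moving the mass of each cell of \<open>\<mu>\<close> to an admissible discrete
  measure near a point of that cell hardly changes the integrals, and a mixture of measures whose atoms
  in \<open>S\<close> have mass at most \<open>e\<close> is again of this kind. The bound \<open>e = 0\<close> serves nowhere dense sets, a
  small \<open>e > 0\<close> serves atomlessness.
\<close>

lemma nonempty_open_contains_discrete_measure:
  fixes X :: "'a topology"
  assumes N: "openin (prob_topology X) N" "N \<noteq> {}"
    and near: "\<And>U. openin X U \<Longrightarrow> U \<noteq> {} \<Longrightarrow> \<exists>p. set_pmf p \<subseteq> U \<and> (\<forall>x\<in>S. pmf p x \<le> e)"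
  obtains \<nu> p where "\<nu> \<in> N" "set_pmf p \<subseteq> topspace X" "\<And>x. x \<in> S \<Longrightarrow> pmf p x \<le> e"
    "\<And>A. A \<in> sets \<nu> \<Longrightarrow> measure \<nu> A = measure (measure_pmf p) A"
proof -
  obtain \<mu> where \<mu>N: "\<mu> \<in> N" using N(2) by blast
  have "N \<subseteq> prob_measures X" using openin_subset[OF N(1)] by (simp add: topspace_prob_topology)
  then have \<mu>: "\<mu> \<in> prob_measures X" using \<mu>N by blast
  interpret \<mu>: prob_space \<mu> by (rule prob_space_of_prob_measures[OF \<mu>])
  have sp: "space \<mu> = topspace X" by (rule space_of_prob_measures[OF \<mu>])
  obtain x0 where x0: "x0 \<in> topspace X" using \<mu>.not_empty unfolding sp by blast
  obtain fs d where d: "d > 0"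
    and fs: "\<And>f. f \<in> set fs \<Longrightarrow> continuous_map X euclideanreal f \<and> bounded (f ` topspace X)"
    and nb: "\<And>\<nu>. \<nu> \<in> prob_measures X \<Longrightarrow>
       (\<And>f. f \<in> set fs \<Longrightarrow> \<bar>(\<integral>x. f x \<partial>\<nu>) - (\<integral>x. f x \<partial>\<mu>)\<bar> < d) \<Longrightarrow> \<nu> \<in> N"
    using prob_topology_neighbourhood[OF N(1) \<mu>N] by metis
  define \<delta> where "\<delta> = d / 3"
  have \<delta>: "\<delta> > 0" using d by (simp add: \<delta>_def)
  \<comment> \<open>The vector of rounded values identifies the cell of \<open>x\<close>.\<close>
  define c where "c x = map (\<lambda>f. \<lfloor>f x / \<delta>\<rfloor>) fs" for x
  have fm: "f \<in> borel_measurable \<mu>" if "f \<in> set fs" for f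
    using fs[OF that] continuous_map_measurable[OF \<mu>] by blast
  have c_meas: "c \<in> measurable \<mu> (count_space UNIV)"
  proof (subst measurable_count_space_eq2_countable, intro conjI ballI)
    fix l :: "int list"
    have fl: "{x \<in> space \<mu>. \<lfloor>(fs ! i) x / \<delta>\<rfloor> = l ! i} \<in> sets \<mu>" if "i \<in> {..<length fs}" for i
    proof -
      have [measurable]: "fs ! i \<in> borel_measurable \<mu>" using that fm by simp
      show ?thesis by measurable
    qed
    show "c -` {l} \<inter> space \<mu> \<in> sets \<mu>"
    proof (cases "length l = length fs")
      case True
      then have "c -` {l} \<inter> space \<mu> = {x \<in> space \<mu>. \<forall>i\<in>{..<length fs}. \<lfloor>(fs ! i) x / \<delta>\<rfloor> = l ! i}"
        by (auto simp: c_def list_eq_iff_nth_eq)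
      also have "\<dots> \<in> sets \<mu>"
        by (rule sets.sets_Collect_finite_All[OF fl]) auto
      finally show ?thesis .
    next
      case False
      then have "c -` {l} = {}" by (auto simp: c_def)
      then show ?thesis by simp
    qed
  qed auto
  define q where "q = Abs_pmf (distr \<mu> (count_space UNIV) c)"
  interpret D: prob_space "distr \<mu> (count_space UNIV) c"
    by (rule \<mu>.prob_space_distr[OF c_meas])
  have q: "measure_pmf q = distr \<mu> (count_space UNIV) c"
    unfolding q_def
  proof (rule Abs_pmf_inverse, intro CollectI conjI)
    show "AE x in distr \<mu> (count_space UNIV) c. measure (distr \<mu> (count_space UNIV) c) {x} \<noteq> 0"
      by (subst D.AE_support_countable) (auto intro!: exI[of _ UNIV])
  qed (auto intro: D.prob_space_axioms)

  \<comment> \<open>The mass of a cell is gathered at one of its points \<open>y l\<close> and then spread over an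
    admissible discrete measure close to \<open>y l\<close>.\<close>
  have "\<exists>z\<in>topspace X. l \<in> c ` topspace X \<longrightarrow> c z = l" for l
    using x0 by (cases "l \<in> c ` topspace X") auto
  then obtain y where y_top: "\<And>l. y l \<in> topspace X"
    and cy': "\<And>l. l \<in> c ` topspace X \<longrightarrow> c (y l) = l"
    by metis
  have cy: "c (y (c x)) = c x" if "x \<in> topspace X" for x
    using cy' that by blast
  have fy: "\<bar>f (y (c x)) - f x\<bar> \<le> \<delta>" if x: "x \<in> topspace X" and f: "f \<in> set fs" for x f
  proof -
    have "\<lfloor>f (y (c x)) / \<delta>\<rfloor> = \<lfloor>f x / \<delta>\<rfloor>"
      using cy[OF x] f by (auto simp: c_def)
    then have "\<bar>f (y (c x)) / \<delta> - f x / \<delta>\<bar> \<le> 1" by linarith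
    then have "\<bar>f (y (c x)) - f x\<bar> / \<delta> \<le> 1"
      using \<delta> by (simp add: diff_divide_distrib[symmetric])
    then show ?thesis using \<delta> by simp
  qed
  define U where "U l = (\<Inter>f\<in>set fs. {z \<in> topspace X. f z \<in> ball (f (y l)) \<delta>}) \<inter> topspace X" for l
  have "openin X (U l)" for l
    unfolding U_def
    by (intro openin_INT openin_continuous_map_preimage[where Y=euclideanreal]) (use fs in auto)
  moreover have "y l \<in> U l" for l
    using y_top \<delta> by (auto simp: U_def)
  ultimately have "\<exists>p. set_pmf p \<subseteq> U l \<and> (\<forall>x\<in>S. pmf p x \<le> e)" for l
    using near by blast
  then obtain P where P: "\<And>l. set_pmf (P l) \<subseteq> U l" "\<And>l x. x \<in> S \<Longrightarrow> pmf (P l) x \<le> e"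
    by metis
  define p where "p = bind_pmf q P"
  have p_top: "set_pmf p \<subseteq> topspace X"
    using P(1) by (auto simp: p_def U_def)
  have p_le: "pmf p x \<le> e" if "x \<in> S" for x
    unfolding p_def pmf_bind using P(2)[OF that]
    by (intro measure_pmf.integral_le_const measure_pmf.integrable_const_bound[where B=1])
      (auto simp: pmf_le_1)
  \<comment> \<open>A total retraction onto \<open>X\<close>, to push \<open>p\<close> forward to the Borel sets of \<open>X\<close>.\<close>
  define h where "h x = (if x \<in> topspace X then x else x0)" for x
  have h: "h x \<in> topspace X" for x using x0 by (simp add: h_def)
  define \<nu> where "\<nu> = distr (measure_pmf p) (borel_of X) h"
  have h_meas: "h \<in> measurable (measure_pmf p) (borel_of X)" using h by simp
  have \<nu>: "\<nu> \<in> prob_measures X"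
    unfolding \<nu>_def prob_measures_def
    using measure_pmf.prob_space_distr[OF h_meas] by simp
  have measure_\<nu>: "measure \<nu> A = measure (measure_pmf p) A" if "A \<in> sets \<nu>" for A
  proof -
    have "measure \<nu> A = measure (measure_pmf p) (h -` A)"
      unfolding \<nu>_def using that by (subst measure_distr[OF h_meas]) (auto simp: \<nu>_def)
    also have "\<dots> = measure (measure_pmf p) A"
      using p_top by (intro measure_pmf.finite_measure_eq_AE) (auto simp: AE_measure_pmf_iff h_def subset_iff)
    finally show ?thesis .
  qed
  have "\<bar>(\<integral>x. f x \<partial>\<nu>) - (\<integral>x. f x \<partial>\<mu>)\<bar> < d" if f: "f \<in> set fs" for f
  proof -
    obtain B where B: "\<And>x. x \<in> topspace X \<Longrightarrow> \<bar>f x\<bar> \<le> B"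
      using fs[OF f] by (auto simp: bounded_iff)
    have Bh: "\<bar>f (h x)\<bar> \<le> B" for x using B h by blast
    define g where "g l = (\<integral>x. f (h x) \<partial>measure_pmf (P l))" for l
    have int_h: "integrable (measure_pmf r) (\<lambda>x. f (h x))" for r
      using Bh by (intro measure_pmf.integrable_const_bound[where B=B]) auto
    have g_near: "\<bar>g l - f (y l)\<bar> \<le> \<delta>" for l
    proof -
      have near: "\<bar>f (h x) - f (y l)\<bar> \<le> \<delta>" if "x \<in> set_pmf (P l)" for x
        using that P(1)[of l] f by (force simp: U_def h_def dist_real_def)
      have "g l - f (y l) = (\<integral>x. f (h x) - f (y l) \<partial>measure_pmf (P l))"
        using int_h by (simp add: g_def)
      moreover have "(\<integral>x. f (h x) - f (y l) \<partial>measure_pmf (P l)) \<le> \<delta>"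
        using near int_h by (intro measure_pmf.integral_le_const) (auto simp: AE_measure_pmf_iff abs_le_iff)
      moreover have "(\<integral>x. f (h x) - f (y l) \<partial>measure_pmf (P l)) \<ge> - \<delta>"
        using near int_h
        by (intro measure_pmf.integral_ge_const) (fastforce simp: AE_measure_pmf_iff abs_le_iff)+
      ultimately show ?thesis by linarith
    qed
    have gB: "\<bar>g l\<bar> \<le> B" for l
      unfolding g_def using Bh int_h
      by (intro abs_leI measure_pmf.integral_le_const)
        (auto simp: abs_le_iff minus_le_iff simp flip: integral_minus intro!: measure_pmf.integral_le_const)
    have gc_meas: "(\<lambda>x. g (c x)) \<in> borel_measurable \<mu>"
      by (rule measurable_compose[OF c_meas]) simp
    have gc_int: "integrable \<mu> (\<lambda>x. g (c x))"
      using gB gc_meas by (intro \<mu>.integrable_const_bound[where B=B]) auto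
    have f_int: "integrable \<mu> f" using fs[OF f] continuous_map_integrable[OF \<mu>] by blast
    have "f \<in> borel_measurable (borel_of X)"
      using fm[OF f] measurable_cong_sets[OF sets_of_prob_measures[OF \<mu>] refl] by blast
    then have "(\<integral>x. f x \<partial>\<nu>) = (\<integral>x. f (h x) \<partial>measure_pmf p)"
      unfolding \<nu>_def by (rule integral_distr[OF h_meas])
    also have "\<dots> = (\<integral>l. g l \<partial>measure_pmf q)"
      unfolding p_def g_def by (rule integral_bind_pmf_bounded[OF Bh])
    also have "\<dots> = (\<integral>x. g (c x) \<partial>\<mu>)"
      unfolding q by (rule integral_distr[OF c_meas]) simp
    finally have "(\<integral>x. f x \<partial>\<nu>) - (\<integral>x. f x \<partial>\<mu>) = (\<integral>x. g (c x) - f x \<partial>\<mu>)"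
      using gc_int f_int by simp
    moreover have near: "g (c x) - f x \<le> 2 * \<delta>" "- (2 * \<delta>) \<le> g (c x) - f x"
      if "x \<in> space \<mu>" for x
      using g_near[of "c x"] fy[OF that[unfolded sp] f] by linarith+
    have "(\<integral>x. g (c x) - f x \<partial>\<mu>) \<le> 2 * \<delta>"
      using near gc_int f_int by (intro \<mu>.integral_le_const AE_I2) auto
    moreover have "(\<integral>x. g (c x) - f x \<partial>\<mu>) \<ge> - (2 * \<delta>)"
      using near gc_int f_int by (intro \<mu>.integral_ge_const AE_I2) auto
    ultimately show ?thesis using d by (simp add: \<delta>_def)
  qed
  then have "\<nu> \<in> N" by (rule nb[OF \<nu>])
  then show ?thesis using that p_top p_le measure_\<nu> by blast
qed

section \<open>Meager sets are residually null\<close>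

text \<open>
  The set is open by semicontinuity. It is dense because the complement of \<open>F\<close> meets every nonempty
  open set, so that discrete measures supported off \<open>F\<close> are dense.
\<close>

lemma closed_nowhere_dense_comeager_measure_less:
  assumes X: "metrizable_space X" and F: "closedin X F" "X interior_of F = {}" and r: "r > 0"
  shows "comeager_in (prob_topology X) {\<mu> \<in> prob_measures X. measure \<mu> F < r}" (is "comeager_in ?T ?G")
proof (rule comeager_in_dense_open)
  show "openin ?T ?G" by (rule openin_prob_topology_measure_closed[OF X F(1)])
  show "?T closure_of ?G = topspace ?T"
    unfolding dense_intersects_open
  proof (intro allI impI)
    fix N assume N: "openin ?T N \<and> N \<noteq> {}"
    have "\<exists>p. set_pmf p \<subseteq> U \<and> (\<forall>x\<in>F. pmf p x \<le> 0)" if "openin X U" "U \<noteq> {}" for U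
    proof -
      have "\<not> U \<subseteq> F" using that F(2) by (auto simp: interior_of_eq_empty)
      then obtain z where "z \<in> U" "z \<notin> F" by blast
      then show ?thesis by (intro exI[of _ "return_pmf z"]) (auto simp: indicator_def)
    qed
    then obtain \<nu> p where \<nu>: "\<nu> \<in> N" and p: "\<And>x. x \<in> F \<Longrightarrow> pmf p x \<le> 0"
      and m: "\<And>A. A \<in> sets \<nu> \<Longrightarrow> measure \<nu> A = measure (measure_pmf p) A"
      using nonempty_open_contains_discrete_measure[of X N F 0] N by metis
    have \<nu>': "\<nu> \<in> prob_measures X"
      using \<nu> N openin_subset[of ?T N] by (auto simp: topspace_prob_topology)
    have "set_pmf p \<inter> F = {}"
      using p by (auto simp: set_pmf_iff order_antisym)
    then have "measure (measure_pmf p) F = 0" by (simp add: measure_pmf_zero_iff)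
    then have "measure \<nu> F = 0" using m closed_in_sets[OF \<nu>' F(1)] by simp
    then show "?G \<inter> N \<noteq> {}" using \<nu> \<nu>' r by auto
  qed
qed

lemma outer_measure_zero_iff:
  "outer_measure_of \<mu> A = 0 \<and> A \<subseteq> space \<mu> \<longleftrightarrow> (\<exists>N\<in>null_sets \<mu>. A \<subseteq> N)"
proof
  assume "outer_measure_of \<mu> A = 0 \<and> A \<subseteq> space \<mu>"
  then show "\<exists>N\<in>null_sets \<mu>. A \<subseteq> N"
    using outer_measure_of_attain[of A \<mu>] by (metis null_setsI)
next
  assume "\<exists>N\<in>null_sets \<mu>. A \<subseteq> N"
  then obtain N where N: "N \<in> null_sets \<mu>" "A \<subseteq> N" by blast
  then have "outer_measure_of \<mu> A \<le> outer_measure_of \<mu> N" by (intro outer_measure_of_mono)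
  moreover have "outer_measure_of \<mu> N = 0"
    using N(1) by (simp add: null_setsD1 null_setsD2 outer_measure_of_eq)
  ultimately show "outer_measure_of \<mu> A = 0 \<and> A \<subseteq> space \<mu>"
    using N sets.sets_into_space[of N \<mu>] by auto
qed

lemma null_measures_iff:
  assumes "A \<subseteq> topspace X" "\<mu> \<in> prob_measures X"
  shows "\<mu> \<in> null_measures X A \<longleftrightarrow> (\<exists>N\<in>null_sets \<mu>. A \<subseteq> N)"
  using assms outer_measure_zero_iff[of \<mu> A] space_of_prob_measures[of \<mu> X]
  by (simp add: null_measures_def)

lemma meager_imp_residually_null:
  assumes X: "metrizable_space X" and A: "meager_in X A"
  shows "residually_null X A"
proof -
  obtain F where F: "\<And>n::nat. nowhere_dense_in X (F n)" "A = (\<Union>n. F n)"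
    using A unfolding meager_in_def by metis
  define C where "C n = X closure_of F n" for n
  have C: "closedin X (C n)" "X interior_of (C n) = {}" for n
    using F(1)[of n] by (auto simp: C_def nowhere_dense_in_def)
  have Asub: "A \<subseteq> topspace X" using F by (auto simp: nowhere_dense_in_def)
  let ?G = "\<Inter>n. \<Inter>k. {\<mu> \<in> prob_measures X. measure \<mu> (C n) < 1 / Suc k}"
  have "comeager_in (prob_topology X) ?G"
    by (intro comeager_in_INT closed_nowhere_dense_comeager_measure_less[OF X] C) simp
  moreover have "?G \<subseteq> null_measures X A"
  proof
    fix \<mu> assume "\<mu> \<in> ?G"
    then have \<mu>: "\<mu> \<in> prob_measures X" and less: "\<And>n k. measure \<mu> (C n) < 1 / Suc k" by auto
    interpret prob_space \<mu> by (rule prob_space_of_prob_measures[OF \<mu>])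
    have "measure \<mu> (C n) = 0" for n
      using less[of n] nat_approx_posE[of "measure \<mu> (C n)"]
      by (metis measure_nonneg less_asym order_le_less)
    then have "C n \<in> null_sets \<mu>" for n
      using closed_in_sets[OF \<mu> C(1)] by (simp add: null_sets_def emeasure_eq_measure)
    then have "(\<Union>n. C n) \<in> null_sets \<mu>" by blast
    moreover have "F n \<subseteq> C n" for n
      using F(1)[of n] unfolding C_def nowhere_dense_in_def by (intro closure_of_subset) simp
    then have "A \<subseteq> (\<Union>n. C n)" unfolding F(2) by (intro UN_mono) auto
    ultimately show "\<mu> \<in> null_measures X A" using null_measures_iff[OF Asub \<mu>] by blast
  qed
  moreover have "null_measures X A \<subseteq> topspace (prob_topology X)"
    by (auto simp: null_measures_def topspace_prob_topology)
  ultimately show ?thesis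
    using Asub comeager_in_mono unfolding residually_null_def by blast
qed

lemma BP_subset_EBP:
  assumes "metrizable_space X"
  shows "BP X \<subseteq> EBP X"
  using meager_imp_residually_null[OF assms] by (auto simp: BP_def EBP_def)

section \<open>Cardinals below the continuum\<close>

lemma Card_order_continuum: "Card_order continuum"
  unfolding continuum_def by (rule card_of_Card_order)

lemma Field_continuum: "Field continuum = UNIV"
  unfolding continuum_def by (rule Field_card_of)

lemma countable_ordLess_continuum:
  assumes "countable A"
  shows "|A| <o continuum"
proof -
  have "|A| \<le>o |UNIV :: nat set|"
    using assms unfolding countable_def card_of_ordLeq[symmetric] by auto
  then show ?thesis
    using card_of_Pow[of "UNIV :: nat set", unfolded Pow_UNIV]
    unfolding continuum_def by (rule ordLeq_ordLess_trans)
qed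

lemma Un_ordLess_continuum:
  assumes "|A| <o continuum" "|B| <o continuum"
  shows "|A \<union> B| <o continuum"
proof (rule card_of_Un_ordLess_infinite_Field[OF _ Card_order_continuum assms])
  show "infinite (Field continuum)" unfolding Field_continuum by (simp add: Finite_Set.finite_set)
qed

lemma image_ordLess_continuum: "|A| <o continuum \<Longrightarrow> |f ` A| <o continuum"
  by (rule ordLeq_ordLess_trans[OF card_of_image])

lemma Times_nat_ordLess_continuum:
  assumes "|A| <o continuum"
  shows "|A \<times> (UNIV :: nat set)| <o continuum"
proof (cases "finite A")
  case True
  then show ?thesis by (intro countable_ordLess_continuum) (auto simp: countable_finite)
next
  case False
  then have "|A \<times> (UNIV :: nat set)| =o |A|"
    using card_of_Times_infinite[of A "UNIV :: nat set"] infinite_iff_card_of_nat by blast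
  then show ?thesis using assms ordIso_ordLess_trans by blast
qed

lemma under_ordLess_continuum: "|under continuum a| <o continuum"
proof -
  have "|underS continuum a| <o continuum"
    using card_of_underS[OF Card_order_continuum] by (simp add: Field_continuum)
  moreover have "|{a}| <o continuum" by (simp add: countable_ordLess_continuum)
  ultimately have "|underS continuum a \<union> {a}| <o continuum" by (rule Un_ordLess_continuum)
  moreover have "under continuum a \<subseteq> underS continuum a \<union> {a}" by (auto simp: under_def underS_def)
  ultimately show ?thesis by (rule ordLeq_ordLess_trans[OF card_of_mono1, rotated])
qed

section \<open>Baire category for fewer than continuum many sets\<close>

text \<open>
  This property, for all Polish spaces, is all that is used of Martin's Axiom or the Continuum
  Hypothesis. It says that the covering number of the meager ideal is the continuum.
\<close>

definition small_Baire :: "'a topology \<Rightarrow> bool" where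
  "small_Baire Y \<longleftrightarrow> (\<forall>\<U>. |\<U>| <o continuum \<and> topspace Y \<noteq> {} \<and>
     (\<forall>U\<in>\<U>. openin Y U \<and> Y closure_of U = topspace Y) \<longrightarrow> topspace Y \<inter> \<Inter>\<U> \<noteq> {})"

lemma CH_imp_small_Baire:
  assumes CH: Continuum_Hypothesis and Y: "Polish_space Y"
  shows "small_Baire Y"
  unfolding small_Baire_def
proof (intro allI impI, elim conjE)
  fix \<U> assume small: "|\<U>| <o continuum" and ne: "topspace Y \<noteq> {}"
    and U: "\<forall>U\<in>\<U>. openin Y U \<and> Y closure_of U = topspace Y"
  have "|\<U>| <o cardSuc natLeq"
    using small CH ordLess_ordIso_trans unfolding Continuum_Hypothesis_def by blast
  then have "|\<U>| \<le>o natLeq"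
    using cardSuc_ordLeq_ordLess[OF natLeq_Card_order card_of_Card_order] by blast
  then have "|\<U>| \<le>o |UNIV :: nat set|"
    using card_of_nat ordIso_symmetric ordLeq_ordIso_trans by blast
  then have "countable \<U>"
    unfolding countable_def card_of_ordLeq[symmetric] by auto
  then have "Y closure_of \<Inter>\<U> = topspace Y"
    using Y U by (intro Baire_category) (auto simp: Polish_space_def)
  then show "topspace Y \<inter> \<Inter>\<U> \<noteq> {}"
    using ne by (metis closure_of_empty closure_of_restrict)
qed

text \<open>
  Martin's Axiom speaks of spaces of type \<^typ>\<open>nat set set\<close>, so \<open>K\<close> is copied there along \<open>j\<close>.
  Separability gives countable cellularity: disjoint nonempty open sets contain different points of a
  countable dense set.
\<close>

lemma Martins_Axiom_any_type:
  fixes K :: "'k topology" and j :: "'k \<Rightarrow> nat set set"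
  assumes MA: Martins_Axiom and j: "inj j"
    and K: "topspace K \<noteq> {}" "compact_space K" "Hausdorff_space K" "separable_space K"
  shows "small_Baire K"
  unfolding small_Baire_def
proof (intro allI impI, elim conjE)
  fix \<U> assume small: "|\<U>| <o continuum"
    and U: "\<forall>U\<in>\<U>. openin K U \<and> K closure_of U = topspace K"
  define J where "J = pullback_topology (range j) (inv j) K"
  have openJ: "openin J S \<longleftrightarrow> (\<exists>V. openin K V \<and> S = j ` V)" for S
  proof -
    have "inv j -` V \<inter> range j = j ` V" for V using j by auto
    then show ?thesis by (simp add: J_def openin_pullback_topology)
  qed
  have topJ: "topspace J = j ` topspace K"
    using j by (auto simp: J_def topspace_pullback_topology)
  have hom: "homeomorphic_map K J j"
  proof (rule bijective_open_imp_homeomorphic_map)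
    show "continuous_map K J j"
      unfolding continuous_map_def
    proof (intro conjI allI impI)
      fix S assume "openin J S"
      then obtain V where V: "openin K V" "S = j ` V" using openJ by blast
      then have "{x \<in> topspace K. j x \<in> S} = V"
        using j openin_subset[OF V(1)] by (auto simp: inj_image_mem_iff)
      then show "openin K {x \<in> topspace K. j x \<in> S}" using V(1) by simp
    qed (use topJ in auto)
    show "open_map K J j" using openJ by (auto simp: open_map_def)
    show "j ` topspace K = topspace J" using topJ by simp
    show "inj_on j (topspace K)" using j inj_on_subset by blast
  qed
  then have sp: "K homeomorphic_space J" by (auto simp: homeomorphic_space)
  have ccc: "countable_cellularity J"
    unfolding countable_cellularity_def
  proof (intro allI impI, elim conjE)
    fix \<V> assume V: "\<forall>V\<in>\<V>. openin J V" and dis: "pairwise disjnt \<V>"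
    obtain C where C: "countable C" "J closure_of C = topspace J"
      using K(4) homeomorphic_separable_space[OF sp] by (auto simp: separable_space_def)
    have "\<forall>V\<in>\<V> - {{}}. \<exists>c\<in>C. c \<in> V"
      using C(2) V unfolding dense_intersects_open by blast
    then obtain g where g: "\<And>V. V \<in> \<V> - {{}} \<Longrightarrow> g V \<in> C \<and> g V \<in> V" by metis
    have "inj_on g (\<V> - {{}})"
    proof (rule inj_onI)
      fix V W assume VW: "V \<in> \<V> - {{}}" "W \<in> \<V> - {{}}" "g V = g W"
      then have "\<not> disjnt V W" using g[of V] g[of W] by (auto simp: disjnt_iff)
      then show "V = W" using dis VW by (auto simp: pairwise_def)
    qed
    moreover have "g ` (\<V> - {{}}) \<subseteq> C" using g by blast
    ultimately have "countable (\<V> - {{}})" using C(1) countable_subset countable_image_inj_on by metis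
    then show "countable \<V>" by (simp add: countable_Diff_eq)
  qed
  obtain e :: "'k set \<Rightarrow> nat set" where e: "inj_on e \<U>"
    using ordLess_imp_ordLeq[OF small] unfolding continuum_def card_of_ordLeq[symmetric] by blast
  define \<kappa> where "\<kappa> = |e ` \<U>|"
  have \<kappa>: "Card_order \<kappa>" "\<kappa> <o continuum"
    unfolding \<kappa>_def by (rule card_of_Card_order, rule image_ordLess_continuum[OF small])
  have "|\<U>| \<le>o \<kappa>" unfolding \<kappa>_def using e card_of_ordLeq by blast
  then have "|image j ` \<U>| \<le>o \<kappa>" using card_of_image ordLeq_transitive by blast
  moreover have "openin J U' \<and> J closure_of U' = topspace J" if "U' \<in> image j ` \<U>" for U'
  proof -
    obtain V where V: "V \<in> \<U>" "U' = j ` V" using \<open>U' \<in> image j ` \<U>\<close> by blast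
    have "openin K V" "K closure_of V = topspace K" using U V(1) by auto
    moreover have "V \<subseteq> topspace K" using \<open>openin K V\<close> by (rule openin_subset)
    ultimately show ?thesis
      using homeomorphic_map_closure_of[OF hom] openJ topJ V(2) by auto
  qed
  moreover have "topspace J \<noteq> {}" "compact_space J" "Hausdorff_space J"
    using K(1-3) topJ homeomorphic_compact_space[OF sp] homeomorphic_Hausdorff_space[OF sp] by auto
  ultimately have "topspace J \<inter> \<Inter>(image j ` \<U>) \<noteq> {}"
    using ccc
    by (intro MA[unfolded Martins_Axiom_def, THEN spec[of _ \<kappa>], THEN mp, OF conjI[OF \<kappa>],
          THEN spec[of _ J], THEN spec[of _ "image j ` \<U>"], THEN mp] conjI ballI)
      blast+
  then obtain z where z: "z \<in> topspace J" "\<And>V. V \<in> \<U> \<Longrightarrow> z \<in> j ` V" by blast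
  then obtain x where x: "x \<in> topspace K" "z = j x" unfolding topJ by blast
  then have "x \<in> V" if "V \<in> \<U>" for V
    using z(2)[OF that] j by (auto dest: injD)
  then show "topspace K \<inter> \<Inter>\<U> \<noteq> {}" using x(1) by blast
qed

text \<open>
  A real is determined by the rationals below it, so a sequence of reals is coded by a set of naturals.
\<close>

lemma ex_inj_real_seq_nat_set_set: "\<exists>j :: (nat \<Rightarrow> real) \<Rightarrow> nat set set. inj j"
proof (intro exI injI)
  fix f g :: "nat \<Rightarrow> real"
  let ?c = "\<lambda>f. to_nat ` {(n, q :: rat). real_of_rat q < f n}"
  assume "{?c f} = {?c g}"
  then have eq: "{(n, q :: rat). real_of_rat q < f n} = {(n, q). real_of_rat q < g n}"
    by (simp add: inj_image_eq_iff)
  then have eq': "real_of_rat q < f n \<longleftrightarrow> real_of_rat q < g n" for n q by blast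
  show "f = g"
  proof
    fix n
    have "\<not> f n < g n" "\<not> g n < f n"
      using eq' of_rat_dense[of "f n" "g n"] of_rat_dense[of "g n" "f n"] by (meson less_asym)+
    then show "f n = g n" by simp
  qed
qed

text \<open>
  The coordinates of \<open>e x\<close> are the truncated distances of \<open>x\<close> to the points of a countable dense set.
\<close>

lemma Polish_space_embeds_in_Hilbert_cube:
  assumes Y: "Polish_space Y" and ne: "topspace Y \<noteq> {}"
  obtains e :: "'a \<Rightarrow> nat \<Rightarrow> real" where
    "embedding_map Y (product_topology (\<lambda>_. top_of_set {0..1}) UNIV) e"
proof -
  obtain M d where "Metric_space M d" and Yd: "Y = Metric_space.mtopology M d"
    using Polish_space_metrizable[OF Y] by (auto simp: metrizable_space_def)
  then interpret Metric_space M d by simp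
  obtain C where C: "countable C" "C \<subseteq> M" "mtopology closure_of C = M"
    using Y Yd by (auto simp: Polish_space_def separable_space_def)
  have "C \<noteq> {}" using C(3) ne Yd by auto
  define a where "a = from_nat_into C"
  have a: "range a = C" unfolding a_def by (rule range_from_nat_into[OF \<open>C \<noteq> {}\<close> C(1)])
  have aM: "a n \<in> M" for n using a C(2) by blast
  have dense: "\<exists>n. d x (a n) < r" if "x \<in> M" "r > 0" for x r
  proof -
    have "x \<in> mtopology closure_of C" using C(3) that by simp
    then obtain y where "y \<in> C" "y \<in> mball x r" using \<open>r > 0\<close> unfolding metric_closure_of by blast
    then show ?thesis using a by (auto simp: in_mball)
  qed
  define e where "e x = (\<lambda>n. min 1 (d x (a n)))" for x
  let ?H = "product_topology (\<lambda>_::nat. top_of_set {0..1::real}) UNIV"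
  have inj: "inj_on e M"
  proof (rule inj_onI)
    fix x y assume xy: "x \<in> M" "y \<in> M" "e x = e y"
    have "\<not> d x y > 0"
    proof
      assume "d x y > 0"
      then obtain n where n: "d x (a n) < min 1 (d x y / 2)"
        using dense[OF xy(1), of "min 1 (d x y / 2)"] by auto
      have "min 1 (d x (a n)) = min 1 (d y (a n))" using xy(3) by (auto simp: e_def fun_eq_iff)
      then have "d y (a n) < d x y / 2" using n by (auto simp: min_def split: if_splits)
      then show False using triangle[OF xy(1) aM[of n] xy(2)] n commute[of y "a n"] by linarith
    qed
    then show "x = y" using xy(1,2) by (metis nonneg order_le_less zero)
  qed
  have cont: "continuous_map Y ?H e"
  proof (subst continuous_map_componentwise_UNIV, intro allI)
    fix n
    have dc: "continuous_map Y euclideanreal (\<lambda>x. d x (a n))"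
    proof -
      have "(\<lambda>x. d x (a n)) = d (a n)" by (rule ext) (rule commute)
      then show ?thesis
        using continuous_on_mdist[of "a n" "metric (M, d)"] aM[of n] by (simp add: Yd)
    qed
    have "continuous_map Y euclideanreal (\<lambda>x. min 1 (d x (a n)))"
      by (intro continuous_map_real_min dc) (simp add: continuous_map_const)
    then show "continuous_map Y (top_of_set {0..1}) (\<lambda>x. e x n)"
      by (auto simp: continuous_map_in_subtopology e_def Pi_iff)
  qed
  have op: "open_map Y (subtopology ?H (e ` M)) e"
    unfolding open_map_def
  proof (intro allI impI)
    fix U assume U: "openin Y U"
    show "openin (subtopology ?H (e ` M)) (e ` U)"
    proof (subst openin_subopen, intro ballI)
      fix z assume "z \<in> e ` U"
      then obtain x where x: "x \<in> U" "z = e x" by blast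
      obtain r where r: "r > 0" "mball x r \<subseteq> U" and xM: "x \<in> M"
        using U x(1) unfolding Yd openin_mtopology by blast
      define s where "s = min 1 (r / 2)"
      have s: "s > 0" "s \<le> 1" "s \<le> r / 2" using r(1) by (auto simp: s_def)
      obtain n where n: "d x (a n) < s" using dense[OF xM s(1)] by blast
      define T where "T = {w \<in> topspace ?H. w n \<in> {..<s}}"
      have "openin ?H {w \<in> topspace ?H. w n \<in> {..<s} \<inter> {0..1}}"
        by (rule openin_continuous_map_preimage[where Y="top_of_set {0..1}"])
          (simp_all add: continuous_map_product_projection[of n UNIV "\<lambda>_. top_of_set {0..1::real}", simplified]
            Int_commute[of "{..<s}"] openin_open_Int)
      moreover have "{w \<in> topspace ?H. w n \<in> {..<s} \<inter> {0..1}} = T"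
        by (auto simp: T_def)
      ultimately have "openin (subtopology ?H (e ` M)) (T \<inter> e ` M)"
        by (simp add: openin_subtopology_Int)
      moreover have "z \<in> T \<inter> e ` M"
        using x(2) xM n s nonneg by (auto simp: T_def e_def)
      moreover have "T \<inter> e ` M \<subseteq> e ` U"
      proof
        fix w assume "w \<in> T \<inter> e ` M"
        then obtain y where y: "y \<in> M" "w = e y" "w n < s" by (auto simp: T_def)
        then have "d y (a n) < s" using s(2) by (auto simp: e_def min_def split: if_splits)
        then have "d x y < r" using triangle[OF xM aM[of n] y(1)] n s(3) commute[of y "a n"] by linarith
        then have "y \<in> mball x r" using xM y(1) by (simp add: in_mball)
        then show "w \<in> e ` U" using r(2) y(2) by blast
      qed
      ultimately show "\<exists>T. openin (subtopology ?H (e ` M)) T \<and> z \<in> T \<and> T \<subseteq> e ` U" by blast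
    qed
  qed
  have "embedding_map Y ?H e"
    unfolding embedding_map_def
  proof (rule bijective_open_imp_homeomorphic_map)
    show "continuous_map Y (subtopology ?H (e ` topspace Y)) e"
      using cont by (simp add: continuous_map_in_subtopology)
    show "open_map Y (subtopology ?H (e ` topspace Y)) e" using op Yd by simp
    show "e ` topspace Y = topspace (subtopology ?H (e ` topspace Y))"
      using continuous_map_image_subset_topspace[OF cont] by auto
    show "inj_on e (topspace Y)" using inj Yd by simp
  qed
  then show ?thesis by (rule that)
qed


text \<open>
  Compactify: let \<open>K\<close> be the closure of a copy \<open>E\<close> of \<open>Y\<close> in the Hilbert cube. Being completely
  metrizable, \<open>E\<close> is the intersection of countably many open sets, which are dense in \<open>K\<close>. The given
  dense open subsets of \<open>Y\<close> extend to dense open subsets of \<open>K\<close>. Martin's Axiom yields a point common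
  to all of these; it lies in \<open>E\<close>.
\<close>

lemma Martins_Axiom_imp_small_Baire:
  fixes Y :: "'a topology"
  assumes MA: Martins_Axiom and Y: "Polish_space Y"
  shows "small_Baire Y"
  unfolding small_Baire_def
proof (intro allI impI, elim conjE)
  fix \<U> assume small: "|\<U>| <o continuum" and ne: "topspace Y \<noteq> {}"
    and U: "\<forall>U\<in>\<U>. openin Y U \<and> Y closure_of U = topspace Y"
  define H where "H = product_topology (\<lambda>_::nat. top_of_set {0..1::real}) UNIV"
  obtain e where e: "embedding_map Y H e"
    using Polish_space_embeds_in_Hilbert_cube[OF Y ne] unfolding H_def by blast
  define E where "E = e ` topspace Y"
  have hom: "homeomorphic_map Y (subtopology H E) e"
    using e by (simp add: embedding_map_def E_def)
  have cont: "continuous_map Y H e"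
    using homeomorphic_imp_continuous_map[OF hom] by (simp add: continuous_map_in_subtopology)
  have EH: "E \<subseteq> topspace H"
    using continuous_map_image_subset_topspace[OF cont] by (simp add: E_def)
  have inj: "inj_on e (topspace Y)"
    using hom by (rule homeomorphic_imp_injective_map)
  have Hcomp: "compact_space H"
    unfolding H_def by (simp add: compact_space_product_topology compact_space_subtopology)
  have Hhaus: "Hausdorff_space H"
    unfolding H_def by (simp add: Hausdorff_space_product_topology Hausdorff_space_subtopology)
  have Hcm: "completely_metrizable_space H"
    unfolding H_def
    by (simp add: completely_metrizable_space_product_topology completely_metrizable_space_closedin
        completely_metrizable_space_euclidean)
  define K where "K = subtopology H (H closure_of E)"
  have topK: "topspace K = H closure_of E"
    by (simp add: K_def closure_of_subset_topspace inf.absorb2)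
  have EK: "E \<subseteq> topspace K" using closure_of_subset[OF EH] topK by simp
  have dense: "K closure_of W = topspace K"
    if D: "D \<subseteq> topspace Y" "Y closure_of D = topspace Y" "e ` D \<subseteq> W" for D W
    unfolding dense_intersects_open
  proof (intro allI impI)
    fix T assume T: "openin K T \<and> T \<noteq> {}"
    then obtain T' where T': "openin H T'" "T = T' \<inter> H closure_of E"
      by (auto simp: K_def openin_subtopology)
    then have "T' \<inter> E \<noteq> {}"
      using T openin_Int_closure_of_eq_empty[OF T'(1)] by blast
    then have "{y \<in> topspace Y. e y \<in> T'} \<noteq> {}" by (auto simp: E_def)
    moreover have "openin Y {y \<in> topspace Y. e y \<in> T'}"
      using cont T'(1) by (rule openin_continuous_map_preimage)
    ultimately obtain y where y: "y \<in> D" "e y \<in> T'" 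
      using D(2) unfolding dense_intersects_open by blast
    have "e y \<in> E" using y D(1) by (auto simp: E_def)
    then have "e y \<in> W \<inter> T" using D(3) y T'(2) EK topK by auto
    then show "W \<inter> T \<noteq> {}" by blast
  qed
  obtain C where C: "countable C" "C \<subseteq> topspace Y" "Y closure_of C = topspace Y"
    using Y by (auto simp: Polish_space_def separable_space_def)
  have "separable_space K"
    unfolding separable_space_def
    using C dense[OF C(2,3) order_refl] order_trans[OF image_mono[OF C(2)] EK[unfolded E_def]]
    by (intro exI[of _ "e ` C"]) auto
  moreover have "compact_space K"
    unfolding K_def using Hcomp
    by (intro compact_space_subtopology closedin_compact_space) auto
  moreover have "Hausdorff_space K"
    unfolding K_def using Hhaus by (rule Hausdorff_space_subtopology)
  moreover have "topspace K \<noteq> {}" using ne EK by (auto simp: E_def)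
  moreover obtain j :: "(nat \<Rightarrow> real) \<Rightarrow> nat set set" where "inj j"
    using ex_inj_real_seq_nat_set_set by blast
  ultimately have K: "small_Baire K"
    using Martins_Axiom_any_type[OF MA] by blast
  have "completely_metrizable_space (subtopology H E)"
    using Y homeomorphic_completely_metrizable_space hom
    unfolding Polish_space_def homeomorphic_space by blast
  then have "gdelta_in H E"
    using completely_metrizable_space_eq_gdelta_in[OF Hcm EH] by simp
  then obtain G where G: "\<And>n::nat. openin H (G n)" "(\<Inter>n. G n) = E"
    unfolding gdelta_in_descending by metis
  have "\<forall>U\<in>\<U>. \<exists>V. openin H V \<and> e ` U = V \<inter> E"
    using U homeomorphic_imp_open_map[OF hom] by (auto simp: open_map_def openin_subtopology)
  then obtain V where V: "\<And>U. U \<in> \<U> \<Longrightarrow> openin H (V U) \<and> e ` U = V U \<inter> E"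
    by metis
  \<comment> \<open>The traces on \<open>K\<close> of the extended dense open sets and of those that cut out \<open>E\<close>.\<close>
  define \<W> where "\<W> = (\<lambda>U. V U \<inter> topspace K) ` \<U> \<union> range (\<lambda>n. G n \<inter> topspace K)"
  have "|\<W>| <o continuum"
    unfolding \<W>_def
    by (intro Un_ordLess_continuum image_ordLess_continuum small countable_ordLess_continuum) auto
  moreover have "openin K W \<and> K closure_of W = topspace K" if W: "W \<in> \<W>" for W
  proof -
    consider U where "U \<in> \<U>" "W = V U \<inter> topspace K" | n where "W = G n \<inter> topspace K"
      using W by (auto simp: \<W>_def)
    then show ?thesis
    proof cases
      case 1
      have "openin K W"
        using V[OF 1(1)] unfolding 1(2) topK by (auto simp: K_def intro: openin_subtopology_Int)
      moreover have "U \<subseteq> topspace Y" "Y closure_of U = topspace Y"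
        using U 1(1) by (auto dest: openin_subset)
      then have "K closure_of W = topspace K"
        using V[OF 1(1)] EK unfolding 1(2) by (intro dense[of U]) auto
      ultimately show ?thesis by simp
    next
      case 2
      have "openin K W"
        using G(1)[of n] unfolding 2 topK by (auto simp: K_def intro: openin_subtopology_Int)
      moreover have "K closure_of W = topspace K"
        using G(2) EK unfolding 2 by (intro dense[of "topspace Y"]) (auto simp: E_def)
      ultimately show ?thesis by simp
    qed
  qed
  ultimately have "topspace K \<inter> \<Inter>\<W> \<noteq> {}"
    using K \<open>topspace K \<noteq> {}\<close> unfolding small_Baire_def by blast
  then obtain z where z: "\<And>W. W \<in> \<W> \<Longrightarrow> z \<in> W" by blast
  have "z \<in> G n" for n using z[of "G n \<inter> topspace K"] by (auto simp: \<W>_def)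
  then have "z \<in> E" using G(2) by blast
  then obtain y where y: "y \<in> topspace Y" "z = e y" by (auto simp: E_def)
  have "y \<in> U" if "U \<in> \<U>" for U
  proof -
    have "z \<in> V U" using z[of "V U \<inter> topspace K"] that by (auto simp: \<W>_def)
    then have "e y \<in> e ` U" using V[OF that] \<open>z \<in> E\<close> y(2) by blast
    then show ?thesis
      using inj y(1) U that openin_subset by (metis inj_on_image_mem_iff)
  qed
  then show "topspace Y \<inter> \<Inter>\<U> \<noteq> {}" using y(1) by blast
qed

lemma small_Baire_avoid_nowhere_dense:
  assumes B: "\<And>Y :: 'a topology. Polish_space Y \<Longrightarrow> small_Baire Y"
    and X: "Polish_space (X :: 'a topology)" and U: "openin X U" "U \<noteq> {}"
    and I: "|I| <o continuum" and F: "\<And>i. i \<in> I \<Longrightarrow> closedin X (F i) \<and> X interior_of (F i) = {}"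
  obtains x where "x \<in> U" "\<And>i. i \<in> I \<Longrightarrow> x \<notin> F i"
proof -
  let ?Y = "subtopology X U"
  have topY: "topspace ?Y = U" using U openin_subset by auto
  have "Polish_space ?Y"
    using X U(1) by (simp add: Polish_space_def separable_space_open_subset completely_metrizable_space_openin)
  then have "small_Baire ?Y" by (rule B)
  moreover have "|(\<lambda>i. U - F i) ` I| <o continuum" by (rule image_ordLess_continuum[OF I])
  moreover have "openin ?Y (U - F i) \<and> ?Y closure_of (U - F i) = topspace ?Y" if "i \<in> I" for i
  proof
    show "openin ?Y (U - F i)"
      using F[OF that] U(1) by (auto simp: openin_open_subtopology)
    show "?Y closure_of (U - F i) = topspace ?Y"
      unfolding dense_intersects_open
    proof (intro allI impI)
      fix T assume "openin ?Y T \<and> T \<noteq> {}"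
      then have T: "openin X T" "T \<noteq> {}" "T \<subseteq> U"
        using U(1) by (auto simp: openin_open_subtopology)
      then have "\<not> T \<subseteq> F i" using F[OF that] by (auto simp: interior_of_eq_empty)
      then show "(U - F i) \<inter> T \<noteq> {}" using T(3) by blast
    qed
  qed
  ultimately have "topspace ?Y \<inter> \<Inter>((\<lambda>i. U - F i) ` I) \<noteq> {}"
    using U(2) topY unfolding small_Baire_def by blast
  then show ?thesis using that topY by blast
qed

section \<open>Sets of fewer than continuum many points are null\<close>

lemma small_open_neighbourhood_base:
  assumes X: "metrizable_space X" and \<mu>: "\<mu> \<in> prob_measures X"
    and base: "\<And>n. openin X (b n)"
      "\<And>U x. openin X U \<Longrightarrow> x \<in> U \<Longrightarrow> \<exists>n::nat. x \<in> b n \<and> b n \<subseteq> U"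
    and x: "x \<in> topspace X" and less: "measure \<mu> {x} < e"
  shows "\<exists>n. x \<in> b n \<and> measure \<mu> (X closure_of b n) < e"
proof -
  interpret prob_space \<mu> by (rule prob_space_of_prob_measures[OF \<mu>])
  obtain V where V: "openin X V" "x \<in> V" "measure \<mu> (X closure_of V) < e"
    using prob_small_open_neighbourhood[OF X \<mu> x less] by blast
  then obtain n where n: "x \<in> b n" "b n \<subseteq> V" using base(2) by blast
  have "measure \<mu> (X closure_of b n) \<le> measure \<mu> (X closure_of V)"
    using n(2) closed_in_sets[OF \<mu>]
    by (intro finite_measure_mono closure_of_mono) auto
  then show ?thesis using n(1) V(3) by (intro exI[of _ n]) simp
qed

lemma Polish_space_Baire_space: "Polish_space (euclidean :: (nat \<Rightarrow> nat discrete) topology)"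
proof -
  obtain D :: "(nat \<Rightarrow> nat discrete) set" where "countable D"
    and D: "\<And>T. open T \<Longrightarrow> T \<noteq> {} \<Longrightarrow> \<exists>d\<in>D. d \<in> T"
    by (rule countable_dense_setE) blast
  then have "separable_space (euclidean :: (nat \<Rightarrow> nat discrete) topology)"
    unfolding separable_space_def dense_intersects_open
    by (intro exI[of _ D]) (auto simp: disjoint_iff)
  then show ?thesis by (simp add: Polish_space_def completely_metrizable_space_euclidean)
qed

text \<open>
  The argument of Rothberger that small sets have strong measure zero. For \<open>x\<close> in \<open>S\<close> and every \<open>n\<close> some
  basic set of measure at most \<open>e / 2 ^ (n + 1)\<close> contains \<open>x\<close>. Hence, for a generic sequence \<open>f\<close> of indices
  of basic sets, some \<open>f n\<close> is the index of such a set: the sequences of this kind form a dense open set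
  \<open>D x\<close>. A sequence in \<open>D x\<close> for all \<open>x\<close> in \<open>S\<close> describes an open cover of \<open>S\<close> of measure at most \<open>e\<close>.
\<close>

lemma open_cover_of_small_set:
  fixes X :: "'a topology"
  assumes B: "small_Baire (euclidean :: (nat \<Rightarrow> nat discrete) topology)"
    and X: "Polish_space X" and \<mu>: "\<mu> \<in> prob_measures X"
    and S: "S \<subseteq> topspace X" "|S| <o continuum" "\<And>x. x \<in> S \<Longrightarrow> measure \<mu> {x} = 0"
    and e: "e > 0"
  shows "\<exists>U. openin X U \<and> S \<subseteq> U \<and> measure \<mu> U \<le> e"
proof -
  interpret prob_space \<mu> by (rule prob_space_of_prob_measures[OF \<mu>])
  obtain b :: "nat \<Rightarrow> 'a set" where b: "\<And>n. openin X (b n)"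
    "\<And>U x. openin X U \<Longrightarrow> x \<in> U \<Longrightarrow> \<exists>n. x \<in> b n \<and> b n \<subseteq> U"
    using Polish_space_countable_base[OF X] by metis
  define \<C> where "\<C> n = {k. measure \<mu> (b k) \<le> e * (1/2) ^ Suc n}" for n
  have \<C>: "\<exists>k\<in>\<C> n. x \<in> b k" if x: "x \<in> S" for x n
  proof -
    have "measure \<mu> {x} < e * (1/2) ^ Suc n" using S(3)[OF x] e by simp
    then obtain k where k: "x \<in> b k" "measure \<mu> (X closure_of b k) < e * (1/2) ^ Suc n"
      using small_open_neighbourhood_base[OF Polish_space_metrizable[OF X] \<mu> b, of x] x S(1) by blast
    have "measure \<mu> (b k) \<le> measure \<mu> (X closure_of b k)"
      using closed_in_sets[OF \<mu>] closure_of_subset[OF openin_subset[OF b(1)]]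
      by (intro finite_measure_mono) auto
    then have "k \<in> \<C> n" using k(2) unfolding \<C>_def mem_Collect_eq by linarith
    then show ?thesis using k(1) by blast
  qed
  define D where "D x = (\<Union>n. (\<lambda>f. f n) -` {k. of_discrete k \<in> \<C> n \<and> x \<in> b (of_discrete k)})"
    for x :: 'a
  have D_open: "open (D x :: (nat \<Rightarrow> nat discrete) set)" for x
    unfolding D_def
    by (intro open_UN ballI open_vimage Discrete_Topology.open_discrete continuous_on_product_coordinates)
  have D_dense: "D x \<inter> T \<noteq> {}" if x: "x \<in> S" and T: "open T" "T \<noteq> {}" for x T
  proof -
    obtain g where "g \<in> T" using T(2) by blast
    then obtain V where V: "finite {i. V i \<noteq> (UNIV :: nat discrete set)}" "g \<in> Pi\<^sub>E UNIV V" "Pi\<^sub>E UNIV V \<subseteq> T"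
      using T(1) unfolding open_fun_def openin_product_topology_alt by auto
    obtain n where n: "V n = UNIV"
      using ex_new_if_finite[OF infinite_UNIV_nat V(1)] by blast
    obtain k where k: "k \<in> \<C> n" "x \<in> b k" using \<C>[OF x] by blast
    have "g(n := discrete k) \<in> Pi\<^sub>E UNIV V" using V(2) n by (auto simp: PiE_iff)
    moreover have "g(n := discrete k) \<in> D x"
      using k unfolding D_def by (intro UN_I[of n]) (auto simp: discrete_inverse)
    ultimately show ?thesis using V(3) by blast
  qed
  have "|D ` S| <o continuum" by (rule image_ordLess_continuum[OF S(2)])
  moreover have "openin euclidean V \<and> euclidean closure_of V = topspace (euclidean :: (nat \<Rightarrow> nat discrete) topology)"
    if "V \<in> D ` S" for V
    using that D_open D_dense unfolding dense_intersects_open by auto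
  ultimately have "topspace euclidean \<inter> \<Inter>(D ` S) \<noteq> {}"
    using B unfolding small_Baire_def by (metis topspace_euclidean UNIV_not_empty)
  then obtain f where f: "\<And>x. x \<in> S \<Longrightarrow> f \<in> D x" by blast
  define U where "U n = (if of_discrete (f n) \<in> \<C> n then b (of_discrete (f n)) else {})" for n
  have U_open: "openin X (U n)" for n using b(1) by (simp add: U_def)
  have U_le: "measure \<mu> (U n) \<le> e * (1/2) ^ Suc n" for n using e by (auto simp: U_def \<C>_def)
  have sums: "(\<lambda>n. e * (1/2) ^ Suc n) sums e"
    using sums_mult[OF power_half_series, of e] by simp
  have summ: "summable (\<lambda>n. measure \<mu> (U n))"
    using U_le by (intro summable_comparison_test'[OF sums_summable[OF sums]]) auto
  have "measure \<mu> (\<Union>n. U n) \<le> (\<Sum>n. measure \<mu> (U n))"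
    using open_in_sets[OF \<mu> U_open] summ by (intro finite_measure_subadditive_countably) auto
  also have "\<dots> \<le> (\<Sum>n. e * (1/2) ^ Suc n)"
    using U_le summ sums_summable[OF sums] by (intro suminf_le)
  also have "\<dots> = e" using sums by (rule sums_unique[symmetric])
  finally have "measure \<mu> (\<Union>n. U n) \<le> e" .
  moreover have "S \<subseteq> (\<Union>n. U n)"
  proof
    fix x assume "x \<in> S"
    then obtain n where "of_discrete (f n) \<in> \<C> n" "x \<in> b (of_discrete (f n))"
      using f unfolding D_def by blast
    then have "x \<in> U n" by (simp add: U_def)
    then show "x \<in> (\<Union>n. U n)" by blast
  qed
  ultimately show ?thesis using U_open by (intro exI[of _ "\<Union>n. U n"]) auto
qed

lemma null_set_if_small_open_covers:
  assumes \<mu>: "\<mu> \<in> prob_measures X"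
    and U: "\<And>n::nat. openin X (U n)" "\<And>n. measure \<mu> (U n) \<le> 1 / Suc n"
  shows "(\<Inter>n. U n) \<in> null_sets \<mu>"
proof -
  interpret prob_space \<mu> by (rule prob_space_of_prob_measures[OF \<mu>])
  have sets: "(\<Inter>n. U n) \<in> sets \<mu>" using open_in_sets[OF \<mu> U(1)] by blast
  have "measure \<mu> (\<Inter>n. U n) \<le> 1 / Suc n" for n
    using finite_measure_mono[of "\<Inter>n. U n" "U n"] open_in_sets[OF \<mu> U(1)] U(2)[of n]
    by (meson INT_lower UNIV_I order_trans)
  then have "\<not> measure \<mu> (\<Inter>n. U n) > 0"
    using nat_approx_posE by (meson not_less)
  then have "measure \<mu> (\<Inter>n. U n) = 0" using measure_nonneg by (metis order_le_less)
  then show ?thesis using sets by (simp add: null_sets_def emeasure_eq_measure)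
qed

section \<open>Generic measures have no atoms in a perfect set\<close>

text \<open>
  An open condition that excludes large atoms in \<open>P\<close>: up to mass \<open>e\<close>, the set \<open>P\<close> is covered by
  finitely many open sets whose closures have mass below \<open>e\<close>. A point of \<open>P\<close> in one of them has mass
  below \<open>e\<close>, and so has a point of \<open>P\<close> in the small remainder. The condition is dense because an open
  set that meets \<open>P\<close> contains enough points of \<open>P\<close> to carry a uniform measure with atoms of mass at
  most \<open>e / 2\<close>.
\<close>

lemma comeager_small_atoms:
  fixes X :: "'a topology"
  assumes X: "Polish_space X" and P: "closedin X P"
    and perfect: "\<And>U. openin X U \<Longrightarrow> U \<inter> P \<noteq> {} \<Longrightarrow> infinite (U \<inter> P)" and e: "e > 0"
  shows "comeager_in (prob_topology X) {\<mu> \<in> prob_measures X. \<forall>x\<in>P. measure \<mu> {x} < e}"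
    (is "comeager_in ?T ?A")
proof -
  have mX: "metrizable_space X" by (rule Polish_space_metrizable[OF X])
  have Psub: "P \<subseteq> topspace X" by (rule closedin_subset[OF P])
  define G where "G \<V> = ((\<Inter>V\<in>\<V>. {\<mu> \<in> prob_measures X. measure \<mu> (X closure_of V) < e}) \<inter> topspace ?T)
    \<inter> {\<mu> \<in> prob_measures X. measure \<mu> (\<Union>\<V> \<union> (topspace X - P)) > 1 - e}" for \<V>
  define \<G> where "\<G> = {\<V>. finite \<V> \<and> (\<forall>V\<in>\<V>. openin X V)}"
  have G_open: "openin ?T (G \<V>)" if "\<V> \<in> \<G>" for \<V>
    unfolding G_def
  proof (rule openin_Int)
    show "openin ?T ((\<Inter>V\<in>\<V>. {\<mu> \<in> prob_measures X. measure \<mu> (X closure_of V) < e}) \<inter> topspace ?T)"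
      using that by (intro openin_INT openin_prob_topology_measure_closed[OF mX]) (auto simp: \<G>_def)
    show "openin ?T {\<mu> \<in> prob_measures X. measure \<mu> (\<Union>\<V> \<union> (topspace X - P)) > 1 - e}"
      using that P by (intro openin_prob_topology_measure_open mX) (auto simp: \<G>_def)
  qed
  have "comeager_in ?T (\<Union>\<V>\<in>\<G>. G \<V>)"
  proof (rule comeager_in_dense_open)
    show "openin ?T (\<Union>\<V>\<in>\<G>. G \<V>)" using G_open by blast
    show "?T closure_of (\<Union>\<V>\<in>\<G>. G \<V>) = topspace ?T"
      unfolding dense_intersects_open
    proof (intro allI impI)
      fix N assume N: "openin ?T N \<and> N \<noteq> {}"
      have "\<exists>p. set_pmf p \<subseteq> U \<and> (\<forall>x\<in>P. pmf p x \<le> e / 2)" if U: "openin X U" "U \<noteq> {}" for U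
      proof (cases "U \<inter> P = {}")
        case True
        obtain z where "z \<in> U" using U(2) by blast
        then show ?thesis using True e by (intro exI[of _ "return_pmf z"]) (auto simp: indicator_def)
      next
        case False
        obtain m :: nat where m: "1 / Suc m < e / 2" using nat_approx_posE[of "e/2"] e by auto
        obtain S where S: "finite S" "card S = Suc m" "S \<subseteq> U \<inter> P"
          using infinite_arbitrarily_large[OF perfect[OF U(1) False]] by blast
        then have "S \<noteq> {}" by auto
        have "pmf (pmf_of_set S) x \<le> e / 2" for x
          using S m e by (simp add: pmf_of_set[OF \<open>S \<noteq> {}\<close> S(1)] indicator_def)
        then show ?thesis using S set_pmf_of_set[OF \<open>S \<noteq> {}\<close> S(1)] by (intro exI[of _ "pmf_of_set S"]) auto
      qed
      then obtain \<nu> p where \<nu>N: "\<nu> \<in> N" and p: "\<And>x. x \<in> P \<Longrightarrow> pmf p x \<le> e / 2"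
        and m: "\<And>A. A \<in> sets \<nu> \<Longrightarrow> measure \<nu> A = measure (measure_pmf p) A"
        using nonempty_open_contains_discrete_measure[of X N P "e / 2"] N by metis
      have \<nu>: "\<nu> \<in> prob_measures X"
        using \<nu>N N openin_subset[of ?T N] by (auto simp: topspace_prob_topology)
      interpret prob_space \<nu> by (rule prob_space_of_prob_measures[OF \<nu>])
      obtain b :: "nat \<Rightarrow> 'a set" where b: "\<And>n. openin X (b n)"
        "\<And>U x. openin X U \<Longrightarrow> x \<in> U \<Longrightarrow> \<exists>n. x \<in> b n \<and> b n \<subseteq> U"
        using Polish_space_countable_base[OF X] by metis
      define \<K> where "\<K> = {k. measure \<nu> (X closure_of b k) < e}"
      have cover: "\<exists>k\<in>\<K>. x \<in> b k" if x: "x \<in> P" for x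
      proof -
        have "closedin X {x}"
          using x Psub metrizable_imp_t1_space[OF mX] by (auto simp: t1_space_closedin_singleton)
        then have "measure \<nu> {x} = pmf p x"
          using m[OF closed_in_sets[OF \<nu>]] by (simp add: measure_pmf_single)
        then have "measure \<nu> {x} < e" using p[OF x] e by simp
        then show ?thesis
          using small_open_neighbourhood_base[OF mX \<nu> b, of x e] x Psub by (auto simp: \<K>_def)
      qed
      define A where "A n = (\<Union>k\<in>\<K> \<inter> {..<n}. b k) \<union> (topspace X - P)" for n
      have A_open: "openin X (A n)" for n using b(1) P by (auto simp: A_def)
      have "(\<Union>n. A n) = topspace X"
      proof (intro equalityI subsetI)
        fix x assume "x \<in> topspace X"
        show "x \<in> (\<Union>n. A n)"
        proof (cases "x \<in> P")
          case True
          then obtain k where "k \<in> \<K>" "x \<in> b k" using cover by blast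
          then have "x \<in> A (Suc k)" by (auto simp: A_def)
          then show ?thesis by blast
        qed (use \<open>x \<in> topspace X\<close> in \<open>auto simp: A_def\<close>)
      qed (use openin_subset[OF A_open] in blast)
      then have "measure \<nu> (\<Union>n. A n) = 1"
        using prob_space by (simp add: space_of_prob_measures[OF \<nu>])
      moreover have "(\<lambda>n. measure \<nu> (A n)) \<longlonglongrightarrow> measure \<nu> (\<Union>n. A n)"
        using open_in_sets[OF \<nu> A_open]
        by (intro finite_Lim_measure_incseq) (auto simp: incseq_Suc_iff A_def)
      ultimately have "\<forall>\<^sub>F n in sequentially. measure \<nu> (A n) > 1 - e"
        using e by (intro order_tendstoD) auto
      then obtain n where n: "measure \<nu> (A n) > 1 - e" by (auto simp: eventually_sequentially)
      have "\<nu> \<in> G (b ` (\<K> \<inter> {..<n}))"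
        using \<nu> n by (auto simp: G_def \<K>_def A_def topspace_prob_topology)
      moreover have "b ` (\<K> \<inter> {..<n}) \<in> \<G>" using b(1) by (auto simp: \<G>_def)
      ultimately show "(\<Union>\<V>\<in>\<G>. G \<V>) \<inter> N \<noteq> {}" using \<nu>N by blast
    qed
  qed
  moreover have "(\<Union>\<V>\<in>\<G>. G \<V>) \<subseteq> ?A"
  proof
    fix \<mu> assume "\<mu> \<in> (\<Union>\<V>\<in>\<G>. G \<V>)"
    then obtain \<V> where \<V>: "\<And>V. V \<in> \<V> \<Longrightarrow> openin X V" "\<mu> \<in> G \<V>" by (auto simp: \<G>_def)
    have \<mu>: "\<mu> \<in> prob_measures X" and gt: "measure \<mu> (\<Union>\<V> \<union> (topspace X - P)) > 1 - e"
      and lt: "\<And>V. V \<in> \<V> \<Longrightarrow> measure \<mu> (X closure_of V) < e"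
      using \<V>(2) by (auto simp: G_def)
    interpret prob_space \<mu> by (rule prob_space_of_prob_measures[OF \<mu>])
    have "measure \<mu> {x} < e" if x: "x \<in> P" for x
    proof (cases "x \<in> \<Union>\<V>")
      case True
      then obtain V where V: "V \<in> \<V>" "x \<in> V" by blast
      then have "{x} \<subseteq> X closure_of V"
        using closure_of_subset[OF openin_subset[OF \<V>(1)]] by blast
      then have "measure \<mu> {x} \<le> measure \<mu> (X closure_of V)"
        using closed_in_sets[OF \<mu>] by (intro finite_measure_mono) auto
      then show ?thesis using lt[OF V(1)] by simp
    next
      case False
      have F: "closedin X (P - \<Union>\<V>)" using P \<V>(1) by (intro closedin_diff) auto
      have "measure \<mu> {x} \<le> measure \<mu> (P - \<Union>\<V>)"
        using False x closed_in_sets[OF \<mu> F] by (intro finite_measure_mono) auto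
      also have "\<dots> = 1 - measure \<mu> (topspace X - (P - \<Union>\<V>))"
        by (rule measure_closed_eq[OF \<mu> F])
      also have "topspace X - (P - \<Union>\<V>) = \<Union>\<V> \<union> (topspace X - P)"
        using \<V>(1) Psub by (auto dest: openin_subset)
      finally show ?thesis using gt by simp
    qed
    then show "\<mu> \<in> ?A" using \<mu> by blast
  qed
  ultimately show ?thesis
    by (rule comeager_in_mono) (auto simp: topspace_prob_topology)
qed

lemma comeager_no_atoms:
  assumes X: "Polish_space X" and P: "closedin X P"
    and perfect: "\<And>U. openin X U \<Longrightarrow> U \<inter> P \<noteq> {} \<Longrightarrow> infinite (U \<inter> P)"
  shows "comeager_in (prob_topology X) {\<mu> \<in> prob_measures X. \<forall>x\<in>P. measure \<mu> {x} = 0}"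
proof (rule comeager_in_mono)
  show "comeager_in (prob_topology X)
      (\<Inter>n::nat. {\<mu> \<in> prob_measures X. \<forall>x\<in>P. measure \<mu> {x} < 1 / Suc n})"
    using comeager_small_atoms[OF X P perfect] by (intro comeager_in_INT) simp
  show "(\<Inter>n::nat. {\<mu> \<in> prob_measures X. \<forall>x\<in>P. measure \<mu> {x} < 1 / Suc n})
      \<subseteq> {\<mu> \<in> prob_measures X. \<forall>x\<in>P. measure \<mu> {x} = 0}"
  proof clarify
    fix \<mu> :: "'a measure" and x
    assume \<mu>: "\<mu> \<in> (\<Inter>n::nat. {\<mu> \<in> prob_measures X. \<forall>x\<in>P. measure \<mu> {x} < 1 / Suc n})"
    have "measure \<mu> {x} = 0" if "x \<in> P" for x
    proof -
      have "measure \<mu> {x} < 1 / Suc n" for n using \<mu> that by auto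
      then have "\<not> measure \<mu> {x} > 0" using nat_approx_posE by (meson less_asym)
      then show ?thesis using measure_nonneg by (metis order_le_less)
    qed
    then show "\<mu> \<in> prob_measures X \<and> (\<forall>x\<in>P. measure \<mu> {x} = 0)" using \<mu> by auto
  qed
qed (auto simp: topspace_prob_topology)

section \<open>A generalized Lusin set\<close>

text \<open>
  Sets of naturals code all triples of a sequence of closed nowhere dense sets, a nonempty open subset of
  \<open>W\<close> and a truth value, because open sets are unions of sets from a countable base. Invalid codes are
  given default values, so that a recursion along the codes needs no case distinction.
\<close>

lemma nat_set_codes:
  fixes X :: "'a topology"
  assumes X: "Polish_space X" and W: "openin X W" "W \<noteq> {}"
  obtains F :: "nat set \<Rightarrow> nat \<Rightarrow> 'a set" and U :: "nat set \<Rightarrow> 'a set" and c :: "nat set \<Rightarrow> bool"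
  where "\<forall>s n. closedin X (F s n) \<and> X interior_of (F s n) = {}"
    "\<forall>s. openin X (U s) \<and> U s \<noteq> {} \<and> U s \<subseteq> W"
    "\<forall>F' U' c'. (\<forall>n. closedin X (F' n) \<and> X interior_of (F' n) = {}) \<and>
       openin X U' \<and> U' \<noteq> {} \<and> U' \<subseteq> W \<longrightarrow> (\<exists>s. F s = F' \<and> U s = U' \<and> c s = c')"
proof -
  obtain b :: "nat \<Rightarrow> 'a set" where b: "\<And>n. openin X (b n)"
    "\<And>U x. openin X U \<Longrightarrow> x \<in> U \<Longrightarrow> \<exists>n. x \<in> b n \<and> b n \<subseteq> U"
    using Polish_space_countable_base[OF X] by metis
  have open_code: "\<exists>S. V = (\<Union>k\<in>S. b k)" if "openin X V" for V
    using b(2)[OF that] by (intro exI[of _ "{k. b k \<subseteq> V}"]) blast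
  define dec where "dec s n = {k. prod_encode (n, k) \<in> s}" for s n
  have dec: "\<exists>s. dec s = S" for S :: "nat \<Rightarrow> nat set"
    by (rule exI[of _ "{m. snd (prod_decode m) \<in> S (fst (prod_decode m))}"])
      (auto simp: dec_def fun_eq_iff)
  define V where "V S = (\<Union>k\<in>S. b k)" for S
  have V_open: "openin X (V S)" for S using b(1) by (auto simp: V_def)
  define F where "F s n = (if X interior_of (topspace X - V (dec s (Suc (Suc n)))) = {}
      then topspace X - V (dec s (Suc (Suc n))) else {})" for s n
  define U where "U s = (if V (dec s 1) \<noteq> {} \<and> V (dec s 1) \<subseteq> W then V (dec s 1) else W)" for s
  define c where "c s = (dec s 0 \<noteq> {})" for s
  show ?thesis
  proof (rule that[of F U c])
    show "\<forall>s n. closedin X (F s n) \<and> X interior_of (F s n) = {}"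
      using V_open by (auto simp: F_def)
    show "\<forall>s. openin X (U s) \<and> U s \<noteq> {} \<and> U s \<subseteq> W"
      using V_open W by (auto simp: U_def)
  next
    have "\<exists>s. F s = F' \<and> U s = U' \<and> c s = c'"
      if F': "\<And>n. closedin X (F' n) \<and> X interior_of (F' n) = {}"
        and U': "openin X U'" "U' \<noteq> {}" "U' \<subseteq> W" for F' U' c'
    proof -
      have "\<forall>n. \<exists>S. topspace X - F' n = V S"
        using F' open_code unfolding V_def by (meson closedin_def)
      then obtain S where S: "\<And>n. topspace X - F' n = V (S n)" by metis
      have FS: "F' n = topspace X - V (S n)" for n
        using F'[of n] closedin_subset unfolding S[symmetric] by blast
      obtain R where R: "U' = V R" using open_code[OF U'(1)] unfolding V_def by blast
      obtain s where s: "dec s = (\<lambda>n. case n of 0 \<Rightarrow> if c' then UNIV else {}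
          | Suc m \<Rightarrow> (case m of 0 \<Rightarrow> R | Suc k \<Rightarrow> S k))" using dec by blast
      have "F s n = F' n" for n using F'[of n] FS[of n] by (simp add: F_def s)
      moreover have "U s = U'" using U' R by (simp add: U_def s)
      moreover have "c s = c'" by (simp add: c_def s)
      ultimately show ?thesis by blast
    qed
    then show "\<forall>F' U' c'. (\<forall>n. closedin X (F' n) \<and> X interior_of (F' n) = {}) \<and>
       openin X U' \<and> U' \<noteq> {} \<and> U' \<subseteq> W \<longrightarrow> (\<exists>s. F s = F' \<and> U s = U' \<and> c s = c')"
      by simp
  qed
qed

lemma continuum_wellorder:
  shows "wf (continuum - Id)" "(a, a) \<in> continuum"
    "a \<noteq> b \<Longrightarrow> (a, b) \<in> continuum \<or> (b, a) \<in> continuum"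
proof -
  have wo: "well_order_on UNIV continuum"
    using Card_order_continuum Field_continuum by (metis card_order_on_well_order_on)
  then show "wf (continuum - Id)" by (simp add: well_order_on_def)
  have "linear_order_on UNIV continuum" using wo by (simp add: well_order_on_def)
  then show "(a, a) \<in> continuum" "a \<noteq> b \<Longrightarrow> (a, b) \<in> continuum \<or> (b, a) \<in> continuum"
    by (auto simp: linear_order_on_def partial_order_on_def preorder_on_def refl_on_def total_on_def)
qed

text \<open>
  Well-order the codes \<open>s\<close> in the order type of the continuum and choose pairwise different points \<open>z s\<close> in
  \<open>U s\<close> that avoid the meager sets coded by all \<open>t \<le> s\<close>. At each stage this excludes fewer than continuum
  many closed nowhere dense sets. Let \<open>A\<close> consist of the \<open>z s\<close> with \<open>c s\<close>. A meager set coded by \<open>t\<close> contains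
  \<open>z s\<close> only for \<open>s < t\<close>, hence fewer than continuum many points of \<open>A\<close>. The truth value serves to defeat the
  Baire property: in every nonempty open subset of \<open>W\<close>, off every meager set, there are both chosen points
  that belong to \<open>A\<close> and chosen points that do not.
\<close>

lemma generalized_Lusin_set:
  fixes X :: "'a topology"
  assumes B: "\<And>Y :: 'a topology. Polish_space Y \<Longrightarrow> small_Baire Y"
    and X: "Polish_space X" and W: "openin X W" "W \<noteq> {}"
    and noiso: "\<And>x. x \<in> W \<Longrightarrow> \<not> openin X {x}"
  obtains A where "A \<subseteq> W" "A \<notin> BP X"
    "\<forall>F :: nat \<Rightarrow> 'a set. (\<forall>n. closedin X (F n) \<and> X interior_of (F n) = {}) \<longrightarrow>
       |A \<inter> (\<Union>n. F n)| <o continuum"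
proof -
  obtain F :: "nat set \<Rightarrow> nat \<Rightarrow> 'a set" and U :: "nat set \<Rightarrow> 'a set" and c :: "nat set \<Rightarrow> bool"
    where F': "\<forall>s n. closedin X (F s n) \<and> X interior_of (F s n) = {}"
    and U': "\<forall>s. openin X (U s) \<and> U s \<noteq> {} \<and> U s \<subseteq> W"
    and code': "\<forall>F' U' c'. (\<forall>n. closedin X (F' n) \<and> X interior_of (F' n) = {}) \<and>
       openin X U' \<and> U' \<noteq> {} \<and> U' \<subseteq> W \<longrightarrow> (\<exists>s. F s = F' \<and> U s = U' \<and> c s = c')"
    by (rule nat_set_codes[OF X W]) (rule that)
  have F: "closedin X (F s n) \<and> X interior_of (F s n) = {}" for s n using F' by blast
  have U: "openin X (U s) \<and> U s \<noteq> {} \<and> U s \<subseteq> W" for s using U' by blast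
  have code: "\<exists>s. F s = F' \<and> U s = U' \<and> c s = c'"
    if "\<forall>n. closedin X (F' n) \<and> X interior_of (F' n) = {}" "openin X U'" "U' \<noteq> {}" "U' \<subseteq> W"
    for F' U' c'
    using code' that by blast
  let ?P = "\<lambda>f s x. x \<in> U s \<and> (\<forall>t\<in>under continuum s. \<forall>n. x \<notin> F t n) \<and> (\<forall>t\<in>underS continuum s. x \<noteq> f t)"
  have sing: "closedin X {x} \<and> X interior_of {x} = {}" if "x \<in> W" for x
  proof
    show "closedin X {x}"
      using that openin_subset[OF W(1)] metrizable_imp_t1_space[OF Polish_space_metrizable[OF X]]
      by (auto simp: t1_space_closedin_singleton)
    have "T = {}" if "openin X T" "T \<subseteq> {x}" for T
      using that noiso[OF \<open>x \<in> W\<close>] by (metis subset_singletonD)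
    then show "X interior_of {x} = {}" by (simp add: interior_of_eq_empty)
  qed
  have "\<exists>z. \<forall>s. ?P z s (z s)"
  proof (rule dependent_wf_choice[OF continuum_wellorder(1)])
    fix f g :: "nat set \<Rightarrow> 'a" and s x
    assume "\<And>t. (t, s) \<in> continuum - Id \<Longrightarrow> f t = g t"
    then have "f t = g t" if "t \<in> underS continuum s" for t using that by (auto simp: underS_def)
    then show "?P f s x = ?P g s x" by simp
  next
    fix s and f :: "nat set \<Rightarrow> 'a"
    assume IH: "\<And>t. (t, s) \<in> continuum - Id \<Longrightarrow> ?P f t (f t)"
    have fW: "f t \<in> W" if "t \<in> underS continuum s" for t
      using IH[of t] U[of t] that by (auto simp: underS_def)
    \<comment> \<open>Index \<open>0\<close> excludes an earlier point, index \<open>Suc m\<close> the \<open>m\<close>-th set of an earlier or the current code.\<close>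
  define H where "H = (\<lambda>(t, n). case n of
        0 \<Rightarrow> if t \<in> underS continuum s then {f t} else {} | Suc m \<Rightarrow> F t m)"
    have "closedin X (H i) \<and> X interior_of (H i) = {}" for i
      using F sing fW by (auto simp: H_def split: prod.splits nat.splits)
    then obtain x where x: "x \<in> U s"
      and avoid: "\<And>i. i \<in> under continuum s \<times> UNIV \<Longrightarrow> x \<notin> H i"
      using small_Baire_avoid_nowhere_dense[OF B X, of "U s" "under continuum s \<times> (UNIV :: nat set)" H]
        U[of s] Times_nat_ordLess_continuum[OF under_ordLess_continuum] by metis
    have "x \<notin> F t n" if "t \<in> under continuum s" for t n
      using avoid[of "(t, Suc n)"] that by (simp add: H_def)
    moreover have "x \<noteq> f t" if t: "t \<in> underS continuum s" for t
    proof -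
      have "t \<in> under continuum s" using t by (auto simp: under_def underS_def)
      then show ?thesis using avoid[of "(t, 0)"] t by (simp add: H_def)
    qed
    ultimately show "\<exists>x. ?P f s x" using x by blast
  qed
  then obtain z where "\<forall>s. ?P z s (z s)" by blast
  then have z: "\<And>s. z s \<in> U s" "\<And>s t n. t \<in> under continuum s \<Longrightarrow> z s \<notin> F t n"
    "\<And>s t. t \<in> underS continuum s \<Longrightarrow> z s \<noteq> z t"
    by auto
  have z_inj: "z s \<noteq> z t" if "s \<noteq> t" for s t
    using continuum_wellorder(3)[OF that] z(3)[of s t] z(3)[of t s] that by (auto simp: underS_def)
  have zF: "z s \<notin> F s n" for s n
    using continuum_wellorder(2)[of s] by (intro z(2)) (simp add: under_def)
  define A where "A = z ` {s. c s}"
  show ?thesis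
  proof (rule that[of A])
    show "A \<subseteq> W" using z(1) U by (auto simp: A_def)
    have "|A \<inter> (\<Union>n. F' n)| <o continuum"
      if F': "\<forall>n. closedin X (F' n) \<and> X interior_of (F' n) = {}" for F' :: "nat \<Rightarrow> 'a set"
    proof -
      obtain t where t: "F t = F'" using code[OF F' W order_refl, where c'=True] by (elim exE conjE)
      have "A \<inter> (\<Union>n. F' n) \<subseteq> z ` under continuum t"
      proof
        fix x assume "x \<in> A \<inter> (\<Union>n. F' n)"
        then obtain s n where s: "x = z s" "z s \<in> F t n" by (auto simp: A_def t)
        then have "(t, s) \<notin> continuum" using z(2)[of t s n] by (auto simp: under_def)
        then have "(s, t) \<in> continuum"
          using continuum_wellorder(2)[of s] continuum_wellorder(3)[of s t] by auto
        then show "x \<in> z ` under continuum t" using s(1) by (auto simp: under_def)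
      qed
      then show ?thesis
        by (rule ordLeq_ordLess_trans[OF card_of_mono1 image_ordLess_continuum[OF under_ordLess_continuum]])
    qed
    then show "\<forall>F :: nat \<Rightarrow> 'a set. (\<forall>n. closedin X (F n) \<and> X interior_of (F n) = {}) \<longrightarrow>
       |A \<inter> (\<Union>n. F n)| <o continuum" by blast
    show "A \<notin> BP X"
    proof
      assume "A \<in> BP X"
      then obtain V where V: "openin X V" "meager_in X (sym_diff V A)" by (auto simp: BP_def)
      obtain M where M: "\<And>n::nat. nowhere_dense_in X (M n)" "sym_diff V A = (\<Union>n. M n)"
        using V(2) unfolding meager_in_def by metis
      define C where "C n = X closure_of M n" for n
      have C: "\<forall>n. closedin X (C n) \<and> X interior_of (C n) = {}"
        using M(1) by (auto simp: C_def nowhere_dense_in_def)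
      have "M n \<subseteq> C n" for n
        using M(1)[of n] unfolding C_def nowhere_dense_in_def by (intro closure_of_subset) simp
      then have cover: "x \<in> V \<longleftrightarrow> x \<in> A" if "\<And>n. x \<notin> C n" for x
        using M(2) that by blast
      \<comment> \<open>If \<open>V\<close> meets \<open>W\<close>, a chosen point outside \<open>A\<close> lies in \<open>V\<close>; otherwise a chosen point of
        \<open>A\<close> lies outside \<open>V\<close>.\<close>
      show False
      proof (cases "V \<inter> W = {}")
        case True
        obtain s where s: "F s = C" "c s" using code[OF C W order_refl, where c'=True] by auto
        then have "z s \<in> V" using cover[of "z s"] zF[of s] by (auto simp: A_def)
        then show False using True z(1)[of s] U[of s] by blast
      next
        case False
        obtain s where s: "F s = C" "U s = V \<inter> W" "\<not> c s"
          using code[OF C openin_Int[OF V(1) W(1)] False Int_lower2, where c'=False] by auto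
        then have "z s \<in> A" using cover[of "z s"] zF[of s] z(1)[of s] by auto
        then obtain t where "c t" "z s = z t" by (auto simp: A_def)
        then show False using s(3) z_inj[of s t] by auto
      qed
    qed
  qed
qed

section \<open>An EBP-set without the Baire property\<close>

lemma infinite_open_without_isolated_points:
  assumes X: "Hausdorff_space X" and V: "openin X V" "V \<noteq> {}"
    and noiso: "\<And>x. x \<in> V \<Longrightarrow> \<not> openin X {x}"
  shows "infinite V"
proof
  assume fin: "finite V"
  obtain x where x: "x \<in> V" using V(2) by blast
  have "closedin X (V - {x})"
    using fin openin_subset[OF V(1)] by (intro closedin_Hausdorff_finite[OF X]) auto
  then have "openin X (V - (V - {x}))" using V(1) by (rule openin_diff[rotated])
  then show False using noiso[OF x] x by (simp add: double_diff)
qed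

text \<open>
  The open set \<open>W\<close> off the closure of the isolated points is nonempty and has no isolated points, so a
  generic measure \<open>\<mu>\<close> has no atoms in its closure \<open>P\<close>. Such a \<open>\<mu>\<close> gives mass zero to a countable dense
  subset of \<open>W\<close>, hence to an intersection of open sets \<open>U n\<close> around it; the rest of \<open>P\<close> is
  meager. The generalized Lusin set \<open>A\<close> has fewer than continuum many points there, and they form a null
  set.
\<close>

lemma BP_psubset_EBP:
  fixes X :: "'a topology"
  assumes B: "\<And>Y :: 'a topology. Polish_space Y \<Longrightarrow> small_Baire Y"
    and B': "small_Baire (euclidean :: (nat \<Rightarrow> nat discrete) topology)"
    and X: "Polish_space X"
    and iso: "X closure_of (isolated_points_in X) \<noteq> topspace X"
  shows "BP X \<subset> EBP X"
proof -
  have mX: "metrizable_space X" by (rule Polish_space_metrizable[OF X])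
  define W where "W = topspace X - X closure_of (isolated_points_in X)"
  have W: "openin X W" "W \<noteq> {}"
    using iso closure_of_subset_topspace[of X "isolated_points_in X"] by (auto simp: W_def)
  have "isolated_points_in X \<subseteq> X closure_of (isolated_points_in X)"
    by (intro closure_of_subset) (auto simp: isolated_points_in_def)
  then have noiso: "\<not> openin X {x}" if "x \<in> W" for x
    using that by (auto simp: W_def isolated_points_in_def)
  define P where "P = X closure_of W"
  have P: "closedin X P" "W \<subseteq> P" "P \<subseteq> topspace X"
    using closure_of_subset[OF openin_subset[OF W(1)]]
    by (auto simp: P_def closure_of_subset_topspace)
  have meets: "V \<inter> W \<noteq> {}" if "openin X V" "V \<inter> P \<noteq> {}" for V
    using that openin_Int_closure_of_eq_empty[OF that(1)] by (auto simp: P_def)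
  have perfect: "infinite (V \<inter> P)" if V: "openin X V" "V \<inter> P \<noteq> {}" for V
  proof -
    have "infinite (V \<inter> W)"
      using meets[OF V] V(1) W(1) noiso
      by (intro infinite_open_without_isolated_points[OF metrizable_imp_Hausdorff_space[OF mX]]) auto
    then show ?thesis using P(2) by (meson Int_mono finite_subset order_refl)
  qed
  obtain A where A: "A \<subseteq> W" "A \<notin> BP X"
    and small: "\<forall>F :: nat \<Rightarrow> 'a set. (\<forall>n. closedin X (F n) \<and> X interior_of (F n) = {}) \<longrightarrow>
       |A \<inter> (\<Union>n. F n)| <o continuum"
    by (rule generalized_Lusin_set[OF B X W noiso]) (assumption | rule that)+
  obtain D where D: "countable D" "D \<subseteq> topspace X" "X closure_of D = topspace X"
    using X by (auto simp: Polish_space_def separable_space_def)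
  have null: "\<mu> \<in> null_measures X A"
    if \<mu>: "\<mu> \<in> prob_measures X" and atoms: "\<And>x. x \<in> P \<Longrightarrow> measure \<mu> {x} = 0" for \<mu>
  proof -
    have null_cover: "\<exists>U. (\<forall>n::nat. openin X (U n) \<and> S \<subseteq> U n) \<and> (\<Inter>n. U n) \<in> null_sets \<mu>"
      if S: "S \<subseteq> P" "|S| <o continuum" for S
    proof -
      have "\<exists>U. openin X U \<and> S \<subseteq> U \<and> measure \<mu> U \<le> 1 / Suc n" for n
        using S P(3) atoms by (intro open_cover_of_small_set[OF B' X \<mu>]) auto
      then obtain U where "\<And>n. openin X (U n) \<and> S \<subseteq> U n \<and> measure \<mu> (U n) \<le> 1 / Suc n" by metis
      then show ?thesis
        using null_set_if_small_open_covers[OF \<mu>, of U] by (intro exI[of _ U]) simp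
    qed
    have "countable (D \<inter> W)" using D(1) by blast
    then obtain U where U: "\<And>n::nat. openin X (U n) \<and> D \<inter> W \<subseteq> U n"
      and U_null: "(\<Inter>n. U n) \<in> null_sets \<mu>"
      using null_cover[of "D \<inter> W"] countable_ordLess_continuum P(2) by blast
    have "\<forall>n. closedin X (P - U n) \<and> X interior_of (P - U n) = {}"
    proof
      fix n
      have "T = {}" if T: "openin X T" "T \<subseteq> P - U n" for T
      proof (rule ccontr)
        assume "T \<noteq> {}"
        then have "T \<inter> W \<noteq> {}" using T by (intro meets) auto
        then have "D \<inter> (T \<inter> W) \<noteq> {}"
          using D(3) T(1) W(1) openin_Int unfolding dense_intersects_open by blast
        then show False using U[of n] T(2) by blast
      qed
      then show "closedin X (P - U n) \<and> X interior_of (P - U n) = {}"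
        using P(1) U[of n] by (auto simp: interior_of_eq_empty intro: closedin_diff)
    qed
    then have "|A \<inter> (\<Union>n. P - U n)| <o continuum"
      by (rule small[THEN spec[of _ "\<lambda>n. P - U n"], THEN mp])
    then obtain V where V: "\<And>n::nat. openin X (V n) \<and> A \<inter> (\<Union>n. P - U n) \<subseteq> V n"
      and V_null: "(\<Inter>n. V n) \<in> null_sets \<mu>"
      using null_cover[of "A \<inter> (\<Union>n. P - U n)"] A(1) P(2) by (metis le_infI1 order_trans)
    have "A \<subseteq> (\<Inter>n. U n) \<union> (\<Inter>n. V n)" using A(1) P(2) V by blast
    moreover have "(\<Inter>n. U n) \<union> (\<Inter>n. V n) \<in> null_sets \<mu>" using U_null V_null by (rule null_sets.Un)
    moreover have "A \<subseteq> topspace X" using A(1) P(2,3) by blast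
    ultimately show ?thesis using null_measures_iff[OF _ \<mu>] by blast
  qed
  have "residually_null X A"
    unfolding residually_null_def
  proof
    show "A \<subseteq> topspace X" using A(1) P(2,3) by blast
    show "comeager_in (prob_topology X) (null_measures X A)"
      by (rule comeager_in_mono[OF comeager_no_atoms[OF X P(1) perfect]])
        (use null in \<open>auto simp: topspace_prob_topology null_measures_def\<close>)
  qed
  then have "A \<in> EBP X"
    using A(1) P(2,3) unfolding EBP_def by (intro CollectI conjI exI[of _ "{}"]) auto
  then show ?thesis using A(2) BP_subset_EBP[OF mX] by blast
qed

theorem mainTheorem3:
  fixes X :: "'a topology"
  assumes "Polish_space X"
  shows "BP X \<subseteq> EBP X \<and>
    (X closure_of (isolated_points_in X) \<noteq> topspace X \<longrightarrow>
      (Martins_Axiom \<longrightarrow> BP X \<subset> EBP X) \<and>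
      (Continuum_Hypothesis \<longrightarrow> BP X \<subset> EBP X))"
proof (intro conjI impI)
  show "BP X \<subseteq> EBP X"
    by (rule BP_subset_EBP[OF Polish_space_metrizable[OF assms]])
  assume iso: "X closure_of (isolated_points_in X) \<noteq> topspace X"
  show "BP X \<subset> EBP X" if MA: Martins_Axiom
    by (rule BP_psubset_EBP[OF _ _ assms iso])
      (intro Martins_Axiom_imp_small_Baire[OF MA] Polish_space_Baire_space; assumption)+
  show "BP X \<subset> EBP X" if CH: Continuum_Hypothesis
    by (rule BP_psubset_EBP[OF _ _ assms iso])
      (intro CH_imp_small_Baire[OF CH] Polish_space_Baire_space; assumption)+
qed

end
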